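(* Let $E$ be a separable infinite-dimensional complex Banach space with open unit ball $B$. Then the set of all $f\in\mathcal{H}^\infty(B)$ for which there exists a disk centered at the origin (depending on $f$ but not on $z$) which is contained in $Cl(f,z)$ for every $z\in\overline{B}^{**}$ is strongly $\mathfrak{c}$-algebrable (as a subset of the algebra $\mathcal{H}^\infty(B)$).
   Context: $E^{**}$ is the topological bidual of $E$ and $\overline{B}^{**}$ denotes the closed unit ball of $E^{**}$; $E$ is regarded as a subspace of $E^{**}$. $\mathcal{H}^\infty(B)$ is the algebra of all bounded holomorphic functions $f:B\to\mathbb{C}$. For $f\in\mathcal{H}^\infty(B)$ and $z\in\overline{B}^{**}$, the cluster set is $$Cl(f,z)=\{\lambda\in\mathbb{C}: \text{there is a net } (x_\alpha)\subset B \text{ with } x_\alpha\to z \text{ in the weak-star topology } w(E^{**},E^* ) \text{ and } f(x_\alpha)\to\lambda\}.$$ A disk means a disk in $\mathbb{C}$ of positive radius. $\mathfrak{c}$ is the cardinality of the continuum. A subset $G=\{x_i:i\in I\}$ of a complex commutative algebra $\mathcal{A}$ is algebraically independent if for every $n\in\mathbb{N}$, every polynomial $Q\in\mathbb{C}[z_1,\dots,z_n]$ and all distinct indices $i_1,\dots,i_n\in I$, $Q(x_{i_1},\dots,x_{i_n})=0$ implies $Q=0$. If $\mathcal{A}$ is an algebra of complex-valued functions on a set and $\kappa$ is a cardinal, a subset $M\subset\mathcal{A}$ is strongly $\kappa$-algebrable if there is a sub-algebra $\mathcal{B}$ of $\mathcal{A}$ generated by an infinite algebraically independent set of generators of cardinality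 $\kappa$ and such that $\mathcal{B}\subset M\cup\{0\}$. Here the generated sub-algebra is not required to contain the unit: it consists of all values $Q(x_{i_1},\dots,x_{i_n})$ of polynomials $Q$ without constant term at generators. *)

theory Defs
  imports "HOL-Analysis.Analysis" "HOL-Library.Poly_Mapping"
begin

unbundle cardinal_syntax

section \<open>Complex normed spaces\<close>

text \<open>The complex scalar multiplication extends the real one, so that the real topological and
  metric library applies to the underlying real normed space.\<close>

class complex_normed_vector = real_normed_vector +
  fixes scaleC :: "complex \<Rightarrow> 'a \<Rightarrow> 'a"  (infixr \<open>*\<^sub>C\<close> 75)
  assumes scaleC_add_right: "c *\<^sub>C (x + y) = c *\<^sub>C x + c *\<^sub>C y"
    and scaleC_add_left: "(c + d) *\<^sub>C x = c *\<^sub>C x + d *\<^sub>C x"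
    and scaleC_scaleC: "c *\<^sub>C d *\<^sub>C x = (c * d) *\<^sub>C x"
    and scaleR_scaleC: "r *\<^sub>R x = complex_of_real r *\<^sub>C x"
    and norm_scaleC: "norm (c *\<^sub>C x) = cmod c * norm x"

class complex_banach = complex_normed_vector + banach

global_interpretation complex_vector: vector_space "scaleC :: complex \<Rightarrow> 'a \<Rightarrow> 'a::complex_normed_vector"
proof
  fix x :: 'a
  show "1 *\<^sub>C x = x"
    using scaleR_scaleC[of 1 x] by simp
qed (auto simp: scaleC_add_right scaleC_add_left scaleC_scaleC)

section \<open>Topological dual and weak-star topology\<close>

typedef (overloaded) 'a cdual =
  "{\<phi> :: 'a::complex_normed_vector \<Rightarrow>\<^sub>L complex. \<forall>c x. blinfun_apply \<phi> (c *\<^sub>C x) = c * blinfun_apply \<phi> x}"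
  morphisms blinfun_of_cdual Abs_cdual
  by (rule exI[of _ 0]) simp

setup_lifting type_definition_cdual

lift_definition cdual_apply :: "'a::complex_normed_vector cdual \<Rightarrow> 'a \<Rightarrow> complex" is blinfun_apply .

instantiation cdual :: (complex_normed_vector) complex_normed_vector
begin

text \<open>The norm is the operator norm, inherited from the type of bounded linear maps.\<close>

lift_definition norm_cdual :: "'a cdual \<Rightarrow> real" is norm .

lift_definition zero_cdual :: "'a cdual" is 0 by simp

lift_definition plus_cdual :: "'a cdual \<Rightarrow> 'a cdual \<Rightarrow> 'a cdual" is "(+)"
  by (simp add: plus_blinfun.rep_eq distrib_left)

lift_definition minus_cdual :: "'a cdual \<Rightarrow> 'a cdual \<Rightarrow> 'a cdual" is "(-)"
  by (simp add: minus_blinfun.rep_eq right_diff_distrib)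

lift_definition uminus_cdual :: "'a cdual \<Rightarrow> 'a cdual" is uminus
  by (simp add: uminus_blinfun.rep_eq)

lift_definition scaleR_cdual :: "real \<Rightarrow> 'a cdual \<Rightarrow> 'a cdual" is scaleR
  by (simp add: scaleR_blinfun.rep_eq)

lift_definition scaleC_cdual :: "complex \<Rightarrow> 'a cdual \<Rightarrow> 'a cdual"
  is "\<lambda>c \<phi>. blinfun_compose (Blinfun ((*) c)) \<phi>"
  by (simp add: bounded_linear_Blinfun_apply bounded_linear_mult_right)

definition dist_cdual :: "'a cdual \<Rightarrow> 'a cdual \<Rightarrow> real"
  where "dist_cdual \<phi> \<psi> = norm (\<phi> - \<psi>)"

definition sgn_cdual :: "'a cdual \<Rightarrow> 'a cdual"
  where "sgn_cdual \<phi> = inverse (norm \<phi>) *\<^sub>R \<phi>"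

definition uniformity_cdual :: "('a cdual \<times> 'a cdual) filter"
  where "uniformity_cdual = (INF e\<in>{0<..}. principal {(\<phi>, \<psi>). dist \<phi> \<psi> < e})"

definition open_cdual :: "'a cdual set \<Rightarrow> bool"
  where "open_cdual S = (\<forall>\<phi>\<in>S. \<forall>\<^sub>F (\<phi>', \<psi>) in uniformity. \<phi>' = \<phi> \<longrightarrow> \<psi> \<in> S)"

instance
proof
  fix \<phi> \<psi> \<chi> :: "'a cdual" and r s :: real and c d :: complex
  show "norm (c *\<^sub>C \<phi>) = cmod c * norm \<phi>"
  proof transfer
    fix c :: complex and \<phi> :: "'a \<Rightarrow>\<^sub>L complex"
    have app: "blinfun_apply (Blinfun ((*) c)) y = c * y" for y
      by (simp add: bounded_linear_Blinfun_apply bounded_linear_mult_right)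
    show "norm (blinfun_compose (Blinfun ((*) c)) \<phi>) = cmod c * norm \<phi>"
    proof (rule antisym)
      show "norm (blinfun_compose (Blinfun ((*) c)) \<phi>) \<le> cmod c * norm \<phi>"
        by (rule norm_blinfun_bound)
          (auto simp: app norm_mult mult.assoc intro!: mult_left_mono norm_blinfun)
      show "cmod c * norm \<phi> \<le> norm (blinfun_compose (Blinfun ((*) c)) \<phi>)"
      proof (cases "c = 0")
        case False
        have "cmod (blinfun_apply \<phi> x)
            \<le> (norm (blinfun_compose (Blinfun ((*) c)) \<phi>) / cmod c) * norm x" for x
          using norm_blinfun[of "blinfun_compose (Blinfun ((*) c)) \<phi>" x] False
          by (simp add: app norm_mult field_simps)
        then have "norm \<phi> \<le> norm (blinfun_compose (Blinfun ((*) c)) \<phi>) / cmod c"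
          by (intro norm_blinfun_bound) auto
        then show ?thesis
          using False by (simp add: field_simps)
      qed simp
    qed
  qed
  show "c *\<^sub>C (\<phi> + \<psi>) = c *\<^sub>C \<phi> + c *\<^sub>C \<psi>" "(c + d) *\<^sub>C \<phi> = c *\<^sub>C \<phi> + d *\<^sub>C \<phi>"
    "c *\<^sub>C d *\<^sub>C \<phi> = (c * d) *\<^sub>C \<phi>" "r *\<^sub>R \<phi> = complex_of_real r *\<^sub>C \<phi>"
    by (transfer, rule blinfun_eqI,
        simp add: bounded_linear_Blinfun_apply bounded_linear_mult_right blinfun.bilinear_simps
          scaleR_conv_of_real algebra_simps)+
  show "dist \<phi> \<psi> = norm (\<phi> - \<psi>)"
    by (fact dist_cdual_def)
  show "sgn \<phi> = inverse (norm \<phi>) *\<^sub>R \<phi>"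
    by (fact sgn_cdual_def)
  show "(uniformity :: ('a cdual \<times> 'a cdual) filter)
      = (INF e\<in>{0<..}. principal {(\<phi>, \<psi>). dist \<phi> \<psi> < e})"
    by (fact uniformity_cdual_def)
  show "open S = (\<forall>\<phi>\<in>S. \<forall>\<^sub>F (\<phi>', \<psi>) in uniformity. \<phi>' = \<phi> \<longrightarrow> \<psi> \<in> S)"
    for S :: "'a cdual set"
    by (fact open_cdual_def)
  show "norm (\<phi> + \<psi>) \<le> norm \<phi> + norm \<psi>"
    by transfer (rule norm_triangle_ineq)
qed (transfer; simp add: algebra_simps)+

end

definition weak_star_topology :: "'a::complex_normed_vector cdual topology" where
  "weak_star_topology = pullback_topology UNIV cdual_apply (product_topology (\<lambda>_. euclidean) UNIV)"

lemma limitin_weak_star: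
  "limitin weak_star_topology \<Phi> \<phi> F \<longleftrightarrow> (\<forall>x. ((\<lambda>i. cdual_apply (\<Phi> i) x) \<longlongrightarrow> cdual_apply \<phi> x) F)"
proof -
  have "limitin weak_star_topology \<Phi> \<phi> F \<longleftrightarrow>
      limitin (product_topology (\<lambda>_. euclidean) UNIV) (\<lambda>i. cdual_apply (\<Phi> i)) (cdual_apply \<phi>) F"
    unfolding weak_star_topology_def limitin_def openin_pullback_topology topspace_pullback_topology
    by auto
  also have "\<dots> \<longleftrightarrow> (\<forall>x. ((\<lambda>i. cdual_apply (\<Phi> i) x) \<longlongrightarrow> cdual_apply \<phi> x) F)"
    by (simp add: limitin_componentwise)
  finally show ?thesis .
qed

lemma bounded_linear_cdual_apply_left: "bounded_linear (\<lambda>\<phi>. cdual_apply \<phi> x)"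
proof (rule bounded_linear_intro)
  show "norm (cdual_apply \<phi> x) \<le> norm \<phi> * norm x" for \<phi> :: "'a cdual"
    by transfer (rule norm_blinfun)
qed (transfer; simp add: blinfun.bilinear_simps)+

lemma cdual_apply_scaleC_left: "cdual_apply (c *\<^sub>C \<phi>) x = c * cdual_apply \<phi> x"
  by transfer (simp add: bounded_linear_Blinfun_apply bounded_linear_mult_right)

lift_definition bidual_embedding :: "'a::complex_normed_vector \<Rightarrow> 'a cdual cdual"
  is "\<lambda>x. Blinfun (\<lambda>\<phi>. cdual_apply \<phi> x)"
  by (simp add: bounded_linear_Blinfun_apply bounded_linear_cdual_apply_left cdual_apply_scaleC_left)

lemma cdual_apply_bidual_embedding: "cdual_apply (bidual_embedding x) \<phi> = cdual_apply \<phi> x"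
  by (simp add: cdual_apply.rep_eq[of "bidual_embedding x"] bidual_embedding.rep_eq
      bounded_linear_Blinfun_apply bounded_linear_cdual_apply_left)

section \<open>Bounded holomorphic functions and cluster sets\<close>

text \<open>Holomorphic means complex Frechet differentiable at every point. Functions on the ball are
  represented by their extensional representatives, so that equality of elements is equality
  on the ball.\<close>

definition Hinf :: "('a::complex_normed_vector \<Rightarrow> complex) set" where
  "Hinf = {f \<in> extensional (ball 0 1).
     (\<forall>x\<in>ball 0 1. \<exists>D. (f has_derivative cdual_apply D) (at x)) \<and> bounded (f ` ball 0 1)}"

text \<open>Nets in the ball are encoded by proper filters containing the ball; the two lemmas
  \<open>cluster_setI_net\<close> and \<open>cluster_setE_net\<close> below show that this yields the cluster
  set defined with nets.\<close>

definition cluster_set :: "('a::complex_normed_vector \<Rightarrow> complex) \<Rightarrow> 'a cdual cdual \<Rightarrow> complex set" where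
  "cluster_set f z = {l. \<exists>F. F \<noteq> bot \<and> (\<forall>\<^sub>F x in F. x \<in> ball 0 1)
     \<and> limitin weak_star_topology bidual_embedding z F \<and> (f \<longlongrightarrow> l) F}"

definition directed_set :: "'i set \<Rightarrow> ('i \<Rightarrow> 'i \<Rightarrow> bool) \<Rightarrow> bool" where
  "directed_set I le \<longleftrightarrow> I \<noteq> {} \<and> reflp_on I le \<and> transp_on I le
     \<and> (\<forall>i\<in>I. \<forall>j\<in>I. \<exists>k\<in>I. le i k \<and> le j k)"

definition net_filter :: "'i set \<Rightarrow> ('i \<Rightarrow> 'i \<Rightarrow> bool) \<Rightarrow> 'i filter" where
  "net_filter I le = (INF i\<in>I. principal {j\<in>I. le i j})"

lemma eventually_net_filter:
  assumes "directed_set I le"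
  shows "eventually P (net_filter I le) \<longleftrightarrow> (\<exists>i\<in>I. \<forall>j\<in>I. le i j \<longrightarrow> P j)"
proof -
  have "eventually P (net_filter I le) \<longleftrightarrow> (\<exists>i\<in>I. eventually P (principal {j\<in>I. le i j}))"
    unfolding net_filter_def
  proof (rule eventually_INF_base)
    show "I \<noteq> {}"
      using assms by (simp add: directed_set_def)
    fix i j assume "i \<in> I" "j \<in> I"
    then obtain k where "k \<in> I" "le i k" "le j k"
      using assms by (auto simp: directed_set_def)
    moreover have "transp_on I le"
      using assms by (simp add: directed_set_def)
    ultimately show "\<exists>k\<in>I. principal {l\<in>I. le k l}
        \<le> inf (principal {l\<in>I. le i l}) (principal {l\<in>I. le j l})"
      using \<open>i \<in> I\<close> \<open>j \<in> I\<close> by (auto intro!: bexI[of _ k] dest: transp_onD)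
  qed
  then show ?thesis
    by (auto simp: eventually_principal)
qed

lemma cluster_setI_net:
  assumes dir: "directed_set I le"
    and ball: "\<And>i. i \<in> I \<Longrightarrow> x i \<in> ball 0 1"
    and lim: "limitin weak_star_topology (\<lambda>i. bidual_embedding (x i)) z (net_filter I le)"
    and f: "((\<lambda>i. f (x i)) \<longlongrightarrow> l) (net_filter I le)"
  shows "l \<in> cluster_set f z"
proof -
  let ?F = "filtermap x (net_filter I le)"
  have "\<not> eventually (\<lambda>_. False) (net_filter I le)"
    unfolding eventually_net_filter[OF dir]
    using dir by (auto simp: directed_set_def dest: reflp_onD)
  then have "?F \<noteq> bot"
    by (auto simp: trivial_limit_def eventually_filtermap)
  moreover have "\<forall>\<^sub>F y in ?F. y \<in> ball 0 1"
    using dir ball by (auto simp: eventually_filtermap eventually_net_filter directed_set_def)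
  moreover have "limitin weak_star_topology bidual_embedding z ?F"
    using lim by (simp add: limitin_def eventually_filtermap)
  moreover have "(f \<longlongrightarrow> l) ?F"
    using f by (simp add: filterlim_filtermap)
  ultimately show ?thesis
    by (auto simp: cluster_set_def)
qed

lemma cluster_setE_net:
  fixes f :: "'a::complex_normed_vector \<Rightarrow> complex"
  assumes "l \<in> cluster_set f z"
  obtains I :: "('a set \<times> 'a) set" and le x
  where "directed_set I le" "\<And>i. i \<in> I \<Longrightarrow> x i \<in> ball 0 1"
    "limitin weak_star_topology (\<lambda>i. bidual_embedding (x i)) z (net_filter I le)"
    "((\<lambda>i. f (x i)) \<longlongrightarrow> l) (net_filter I le)"
proof -
  obtain F where F: "F \<noteq> bot" "\<forall>\<^sub>F x in F. x \<in> ball 0 1"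
    "limitin weak_star_topology bidual_embedding z F" "(f \<longlongrightarrow> l) F"
    using assms by (auto simp: cluster_set_def)
  define I :: "('a set \<times> 'a) set" where "I = {(S, p). S \<subseteq> ball 0 1 \<and> (\<forall>\<^sub>F x in F. x \<in> S) \<and> p \<in> S}"
  define le :: "'a set \<times> 'a \<Rightarrow> 'a set \<times> 'a \<Rightarrow> bool" where "le = (\<lambda>i j. fst j \<subseteq> fst i)"
  have nonempty: "\<exists>p. (S, p) \<in> I" if "S \<subseteq> ball 0 1" "\<forall>\<^sub>F x in F. x \<in> S" for S
    using that eventually_happens'[OF F(1) that(2)] by (auto simp: I_def)
  have dir: "directed_set I le"
    unfolding directed_set_def
  proof (intro conjI ballI)
    show "I \<noteq> {}"
      using nonempty[OF order_refl F(2)] by auto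
    show "reflp_on I le" "transp_on I le"
      by (auto simp: le_def intro!: reflp_onI transp_onI)
    fix i j assume "i \<in> I" "j \<in> I"
    then have "fst i \<inter> fst j \<subseteq> ball 0 1" "\<forall>\<^sub>F x in F. x \<in> fst i \<inter> fst j"
      by (auto simp: I_def eventually_conj_iff)
    from nonempty[OF this] obtain p where "(fst i \<inter> fst j, p) \<in> I"
      by blast
    then show "\<exists>k\<in>I. le i k \<and> le j k"
      by (rule bexI[rotated]) (auto simp: le_def)
  qed
  have ev: "eventually (\<lambda>i. P (snd i)) (net_filter I le)" if "eventually P F" for P
  proof -
    have "\<forall>\<^sub>F x in F. x \<in> ball 0 1 \<inter> {x. P x}"
      using F(2) that by eventually_elim auto
    then obtain p where "(ball 0 1 \<inter> {x. P x}, p) \<in> I"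
      using nonempty[of "ball 0 1 \<inter> {x. P x}"] by auto
    then show ?thesis
      unfolding eventually_net_filter[OF dir]
      by (rule bexI[rotated]) (auto simp: I_def le_def)
  qed
  show thesis
  proof (rule that[OF dir, of snd])
    show "\<And>i. i \<in> I \<Longrightarrow> snd i \<in> ball 0 1"
      by (auto simp: I_def)
    show "limitin weak_star_topology (\<lambda>i. bidual_embedding (snd i)) z (net_filter I le)"
      using F(3) by (auto simp: limitin_def intro: ev)
    show "((\<lambda>i. f (snd i)) \<longlongrightarrow> l) (net_filter I le)"
      using F(4) by (auto simp: tendsto_def intro: ev)
  qed
qed

section \<open>Strong algebrability\<close>

text \<open>Polynomials in $z_0, z_1, \ldots$ are finitely supported maps from exponent vectors to
  coefficients; \<open>polys n\<close> is the ring of those in $z_0, \ldots, z_{n-1}$.\<close>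

definition polys :: "nat \<Rightarrow> ((nat \<Rightarrow>\<^sub>0 nat) \<Rightarrow>\<^sub>0 complex) set" where
  "polys n = {Q. \<forall>m\<in>Poly_Mapping.keys Q. Poly_Mapping.keys m \<subseteq> {..<n}}"

definition eval_poly :: "((nat \<Rightarrow>\<^sub>0 nat) \<Rightarrow>\<^sub>0 complex) \<Rightarrow> (nat \<Rightarrow> complex) \<Rightarrow> complex" where
  "eval_poly Q v = (\<Sum>m\<in>Poly_Mapping.keys Q. Poly_Mapping.lookup Q m * (\<Prod>i\<in>Poly_Mapping.keys m. v i ^ Poly_Mapping.lookup m i))"

text \<open>Value of \<open>Q\<close> at the functions \<open>g 0\<close>, \<open>g 1\<close>, \dots in the algebra of all functions on \<open>X\<close>,
  with the pointwise operations.\<close>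

definition poly_at_funs ::
    "'x set \<Rightarrow> ((nat \<Rightarrow>\<^sub>0 nat) \<Rightarrow>\<^sub>0 complex) \<Rightarrow> (nat \<Rightarrow> 'x \<Rightarrow> complex) \<Rightarrow> 'x \<Rightarrow> complex" where
  "poly_at_funs X Q g = (\<lambda>x\<in>X. eval_poly Q (\<lambda>i. g i x))"

definition algebraically_independent :: "'x set \<Rightarrow> ('x \<Rightarrow> complex) set \<Rightarrow> bool" where
  "algebraically_independent X G \<longleftrightarrow>
     (\<forall>n. \<forall>Q\<in>polys n. \<forall>g. inj_on g {..<n} \<and> g ` {..<n} \<subseteq> G \<and> poly_at_funs X Q g = (\<lambda>x\<in>X. 0)
        \<longrightarrow> Q = 0)"

text \<open>Non-unital: the polynomials have no constant term.\<close>

definition generated_subalgebra :: "'x set \<Rightarrow> ('x \<Rightarrow> complex) set \<Rightarrow> ('x \<Rightarrow> complex) set" where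
  "generated_subalgebra X G =
     {poly_at_funs X Q g | n Q g. Q \<in> polys n \<and> Poly_Mapping.lookup Q 0 = 0 \<and> g ` {..<n} \<subseteq> G}"

text \<open>\<open>A\<close> is an algebra of (extensional) complex functions on \<open>X\<close>, and \<open>\<kappa>\<close> is a cardinal.\<close>

definition strongly_algebrable ::
    "'x set \<Rightarrow> ('x \<Rightarrow> complex) set \<Rightarrow> ('x \<Rightarrow> complex) set \<Rightarrow> 'k rel \<Rightarrow> bool" where
  "strongly_algebrable X A M \<kappa> \<longleftrightarrow> M \<subseteq> A \<and>
     (\<exists>G\<subseteq>A. infinite G \<and> |G| =o \<kappa> \<and> algebraically_independent X G
        \<and> generated_subalgebra X G \<subseteq> M \<union> {\<lambda>x\<in>X. 0})"

end

theory Submission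
  imports Defs "HOL-Complex_Analysis.Complex_Analysis"
begin

text \<open>
  Everything rests on a single \<open>f \<in> Hinf\<close> whose cluster set at each point of the closed ball of the bidual
  contains the open unit disk (\<open>full_cluster_sets\<close>). Let \<open>h\<close> be entire with \<open>h 0 = 0\<close> and not identically zero. The
  cluster sets of \<open>h \<circ> f\<close> all contain the image of the unit disk under \<open>h\<close>, which by the open mapping theorem
  contains a disk centred at \<open>0\<close> that depends on \<open>h\<close> only.

  The generators are the functions \<open>f * exp (a * f)\<close>, where \<open>a\<close> runs through a Hamel basis of the reals
  over the rationals, a set with the cardinality of the continuum. A polynomial \<open>Q\<close> without constant term,
  evaluated at generators, is \<open>h \<circ> f\<close> with \<open>h w = Q (w * exp (a 0 * w), \<dots>)\<close>, so \<open>h\<close> is entire and vanishes at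
  \<open>0\<close>. For real \<open>w\<close> the monomial with exponent vector \<open>m\<close> contributes a power of \<open>w\<close> times an exponential of
  rate \<open>\<Sum>i. m i * a i\<close>. For distinct generators these rates are distinct, so one term dominates at infinity and \<open>h\<close> vanishes
  identically only if \<open>Q = 0\<close> (\<open>poly_eq_0_of_exponentials\<close>); this is algebraic independence.

  To construct \<open>f\<close>, let \<open>d n\<close> be a dense sequence with norming functionals \<open>\<phi> n\<close> (the Hahn-Banach theorem,
  \<open>norming_functional\<close>). The sum \<open>g\<close> of \<open>(1 / 2) ^ n * Ln ((1 - \<phi> n) / 2)\<close> maps the ball holomorphically into the
  half-strip \<open>Re u \<le> 0\<close>, \<open>\<bar>Im u\<bar> \<le> pi\<close>, and \<open>Re g\<close> tends to minus infinity along the radius in the direction of each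
  \<open>d n \<noteq> 0\<close>. A weak-star neighbourhood of a point of the closed bidual ball meets the ball by Goldstine's theorem
  (\<open>goldstine\<close>), and since the dimension is infinite it also meets the unit sphere; as it is norm open in the
  space, it contains the end of one of these radii. Hence \<open>Re g\<close> takes in this neighbourhood every
  sufficiently negative value (\<open>Re_log_sum_attains\<close>). Nothing is known about \<open>Im g\<close> beyond its bound, so one
  composes with a bounded function that oscillates so slowly that its limiting values depend on \<open>Re g\<close>
  alone. The function \<open>exp (\<i> * v) * sin (Ln (1 + v))\<close> with \<open>v = Ln (1 - u)\<close> has this property, and
  since its phase and its modulus vary on different scales, it approximates every point of the unit disk as \<open>Re u\<close>
  tends to minus infinity.
\<close>

section \<open>Norming functionals\<close>

definition sublinear :: "('a::real_vector \<Rightarrow> real) \<Rightarrow> bool" where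
  "sublinear q \<longleftrightarrow> (\<forall>x y. q (x + y) \<le> q x + q y) \<and> (\<forall>t x. 0 \<le> t \<longrightarrow> q (t *\<^sub>R x) = t * q x)"

text \<open>A linear functional below \<open>q\<close> that agrees with \<open>q\<close> at \<open>y\<close> must lie below every term of the infimum.
  Conversely the infimum is at most \<open>- q y\<close> at \<open>- y\<close>, which forces every linear functional below it to agree
  with \<open>q\<close> at \<open>y\<close>. It serves to prescribe the value at a single vector, and to prove
  that minimal sublinear functionals are additive.\<close>

definition shrink_along :: "'a::real_vector \<Rightarrow> ('a \<Rightarrow> real) \<Rightarrow> 'a \<Rightarrow> real" where
  "shrink_along y q x = (INF t\<in>{0..}. q (x + t *\<^sub>R y) - t * q y)"

lemma sublinearD:
  assumes "sublinear q"
  shows sublinear_add: "q (x + y) \<le> q x + q y" and sublinear_scale: "0 \<le> t \<Longrightarrow> q (t *\<^sub>R x) = t * q x"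
  using assms by (auto simp: sublinear_def)

lemma sublinear_minus: "sublinear q \<Longrightarrow> - q (- x) \<le> q x"
  using sublinear_add[of q x "- x"] sublinear_scale[of q 0 0] by simp

lemma bdd_below_shrink_along:
  assumes "sublinear q"
  shows "bdd_below ((\<lambda>t. q (x + t *\<^sub>R y) - t * q y) ` {0..})"
proof (rule bdd_belowI2)
  fix t :: real assume "t \<in> {0..}"
  then have "t * q y \<le> q (x + t *\<^sub>R y) + q (- x)"
    using sublinear_add[OF assms, of "x + t *\<^sub>R y" "- x"] sublinear_scale[OF assms, of t y] by simp
  then show "- q (- x) \<le> q (x + t *\<^sub>R y) - t * q y"
    by simp
qed

lemma shrink_along_le:
  assumes "sublinear q" "0 \<le> t"
  shows "shrink_along y q x \<le> q (x + t *\<^sub>R y) - t * q y"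
  unfolding shrink_along_def
  using assms by (intro cINF_lower bdd_below_shrink_along) auto

lemma shrink_along_greatest:
  assumes "\<And>t. 0 \<le> t \<Longrightarrow> m \<le> q (x + t *\<^sub>R y) - t * q y"
  shows "m \<le> shrink_along y q x"
  unfolding shrink_along_def using assms by (intro cINF_greatest) auto

lemma sublinear_shrink_along:
  assumes q: "sublinear q"
  shows "sublinear (shrink_along y q)"
  unfolding sublinear_def
proof (intro conjI allI impI)
  fix u v
  have "shrink_along y q (u + v) - (q (v + t *\<^sub>R y) - t * q y) \<le> q (u + s *\<^sub>R y) - s * q y"
    if "0 \<le> s" "0 \<le> t" for s t
  proof -
    have "shrink_along y q (u + v) \<le> q ((u + v) + (s + t) *\<^sub>R y) - (s + t) * q y"
      using that by (intro shrink_along_le[OF q]) simp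
    also have "(u + v) + (s + t) *\<^sub>R y = (u + s *\<^sub>R y) + (v + t *\<^sub>R y)"
      by (simp add: algebra_simps)
    also have "q \<dots> \<le> q (u + s *\<^sub>R y) + q (v + t *\<^sub>R y)"
      by (rule sublinear_add[OF q])
    finally show ?thesis
      by (simp add: algebra_simps)
  qed
  then have "shrink_along y q (u + v) - (q (v + t *\<^sub>R y) - t * q y) \<le> shrink_along y q u"
    if "0 \<le> t" for t
    using that by (intro shrink_along_greatest) auto
  then have "shrink_along y q (u + v) - shrink_along y q u \<le> shrink_along y q v"
    by (intro shrink_along_greatest) (simp add: algebra_simps)
  then show "shrink_along y q (u + v) \<le> shrink_along y q u + shrink_along y q v"
    by simp
next
  have le: "shrink_along y q (r *\<^sub>R u) \<le> r * shrink_along y q u" if "0 < r" for r u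
  proof -
    have "shrink_along y q (r *\<^sub>R u) / r \<le> q (u + t *\<^sub>R y) - t * q y" if t: "0 \<le> t" for t
    proof -
      have "shrink_along y q (r *\<^sub>R u) \<le> q (r *\<^sub>R u + (r * t) *\<^sub>R y) - (r * t) * q y"
        using t \<open>0 < r\<close> by (intro shrink_along_le[OF q]) simp
      also have "r *\<^sub>R u + (r * t) *\<^sub>R y = r *\<^sub>R (u + t *\<^sub>R y)"
        by (simp add: algebra_simps)
      also have "q \<dots> = r * q (u + t *\<^sub>R y)"
        using \<open>0 < r\<close> by (simp add: sublinear_scale[OF q])
      finally show ?thesis
        using \<open>0 < r\<close> by (simp add: field_simps)
    qed
    then have "shrink_along y q (r *\<^sub>R u) / r \<le> shrink_along y q u"
      by (rule shrink_along_greatest)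
    then show ?thesis
      using that by (simp add: field_simps)
  qed
  fix r :: real and u assume r: "0 \<le> r"
  show "shrink_along y q (r *\<^sub>R u) = r * shrink_along y q u"
  proof (cases "r = 0")
    case True
    have "q 0 = 0"
      using sublinear_scale[OF q, of 0 0] by simp
    then have "shrink_along y q 0 = 0"
      using shrink_along_le[OF q, of 0 y 0]
      by (intro antisym shrink_along_greatest) (auto simp: sublinear_scale[OF q])
    then show ?thesis
      using True by simp
  next
    case False
    then have "shrink_along y q ((1 / r) *\<^sub>R (r *\<^sub>R u)) \<le> (1 / r) * shrink_along y q (r *\<^sub>R u)"
      using r by (intro le) simp
    then show ?thesis
      using False r le[of r u] by (simp add: field_simps)
  qed
qed

text \<open>Zorn's lemma: the pointwise infimum of a chain is again sublinear, because two members of a chain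
  are comparable and one may evaluate both summands at the smaller one. It is finite since every member below
  \<open>p\<close> is bounded from below by \<open>x \<mapsto> - p (- x)\<close>.\<close>

lemma minimal_sublinear_exists:
  assumes p: "sublinear p"
  obtains q where "sublinear q" "q \<le> p" "\<And>q'. sublinear q' \<Longrightarrow> q' \<le> q \<Longrightarrow> q' = q"
proof -
  let ?A = "{q. sublinear q \<and> q \<le> p}"
  have "\<exists>m\<in>?A. \<forall>a\<in>?A. (\<ge>) m a \<longrightarrow> a = m"
  proof (rule predicate_Zorn)
    show "partial_order_on ?A (relation_of (\<ge>) ?A)"
      by (rule partial_order_on_relation_ofI) auto
    fix C assume "C \<in> Chains (relation_of (\<ge>) ?A)"
    then have C: "\<And>q. q \<in> C \<Longrightarrow> sublinear q \<and> q \<le> p"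
      and chain: "\<And>q q'. q \<in> C \<Longrightarrow> q' \<in> C \<Longrightarrow> q \<le> q' \<or> q' \<le> q"
      by (auto simp: Chains_def relation_of_def)
    show "\<exists>u\<in>?A. \<forall>a\<in>C. u \<le> a"
    proof (cases "C = {}")
      case True
      then show ?thesis
        using p by blast
    next
      case False
      define m where "m x = (INF q\<in>C. q x)" for x
      have bdd: "bdd_below ((\<lambda>q. q x) ` C)" for x
      proof (rule bdd_belowI2)
        fix q assume "q \<in> C"
        then have "sublinear q" "q (- x) \<le> p (- x)"
          using C by (auto simp: le_fun_def)
        then show "- p (- x) \<le> q x"
          using sublinear_minus[of q x] by linarith
      qed
      have le: "m x \<le> q x" if "q \<in> C" for q x
        unfolding m_def using that by (intro cINF_lower bdd)
      have greatest: "b \<le> m x" if "\<And>q. q \<in> C \<Longrightarrow> b \<le> q x" for b x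
        unfolding m_def using that False by (intro cINF_greatest)
      have "sublinear m"
        unfolding sublinear_def
      proof (intro conjI allI impI)
        fix x y
        have "m (x + y) - q' y \<le> q x" if qq: "q \<in> C" "q' \<in> C" for q q'
        proof -
          obtain r where r: "r \<in> C" "r \<le> q" "r \<le> q'"
            using chain[OF qq] qq by blast
          have "m (x + y) \<le> r x + r y"
            using le[OF r(1), of "x + y"] C[OF r(1)] sublinear_add[of r x y] by linarith
          also have "\<dots> \<le> q x + q' y"
            using r by (intro add_mono) (auto simp: le_fun_def)
          finally show ?thesis
            by simp
        qed
        then have "m (x + y) - q' y \<le> m x" if "q' \<in> C" for q'
          using that by (intro greatest)
        then have "m (x + y) - m x \<le> m y"
          by (intro greatest) (simp add: algebra_simps)
        then show "m (x + y) \<le> m x + m y"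
          by simp
      next
        fix t :: real and x assume t: "0 \<le> t"
        have "(INF q\<in>C. q (t *\<^sub>R x)) = (INF q\<in>C. t * q x)"
          using C t by (intro INF_cong) (auto simp: sublinear_scale)
        also have "\<dots> = t * (INF q\<in>C. q x)"
        proof (cases "t = 0")
          case False
          have "mono ((*) t)"
            using t by (auto intro!: monoI mult_left_mono)
          then have "t * Inf ((\<lambda>q. q x) ` C) = Inf ((*) t ` (\<lambda>q. q x) ` C)"
            using False bdd[of x] \<open>C \<noteq> {}\<close>
            by (intro continuous_at_Inf_mono) (auto intro!: continuous_intros)
          then show ?thesis
            by (simp add: image_image)
        qed (use \<open>C \<noteq> {}\<close> in auto)
        finally show "m (t *\<^sub>R x) = t * m x"
          by (simp add: m_def)
      qed
      moreover have "m \<le> p"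
      proof (rule le_funI)
        fix x
        obtain q where "q \<in> C"
          using False by blast
        then show "m x \<le> p x"
          using C[of q] le[of q x] by (auto simp: le_fun_def intro: order_trans)
      qed
      ultimately show ?thesis
        using le by (auto simp: le_fun_def)
    qed
  qed
  then obtain q where "sublinear q" "q \<le> p" and min: "\<And>q'. sublinear q' \<Longrightarrow> q' \<le> p \<Longrightarrow> q' \<le> q \<Longrightarrow> q' = q"
    by auto
  then show thesis
    by (intro that[of q]) (auto intro: order_trans)
qed

text \<open>Minimality gives \<open>shrink_along y q = q\<close>, and the inequality in its definition at \<open>t = 1\<close> is
  then superadditivity.\<close>

lemma minimal_sublinear_linear:
  assumes q: "sublinear q" and min: "\<And>q'. sublinear q' \<Longrightarrow> q' \<le> q \<Longrightarrow> q' = q"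
  shows "linear q"
proof -
  have eq: "shrink_along y q = q" for y
    using sublinear_shrink_along[OF q] shrink_along_le[OF q, of 0]
    by (intro min) (auto simp: le_fun_def)
  have add: "q (x + y) = q x + q y" for x y
    using shrink_along_le[OF q, of 1 y x] sublinear_add[OF q, of x y] by (simp add: eq)
  have minus: "q (- x) = - q x" for x
    using add[of x "- x"] sublinear_scale[OF q, of 0 0] by simp
  show ?thesis
  proof (rule linearI)
    fix r :: real and x
    show "q (r *\<^sub>R x) = r *\<^sub>R q x"
      using sublinear_scale[OF q, of r x] sublinear_scale[OF q, of "- r" x] minus[of "r *\<^sub>R x"]
      by (cases "0 \<le> r") auto
  qed (rule add)
qed

text \<open>A minimal functional below \<open>shrink_along d norm\<close> is linear, lies below the norm, and is at most
  \<open>- norm d\<close> at \<open>- d\<close>, which leaves only the value \<open>norm d\<close> at \<open>d\<close>.\<close>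

lemma real_norming_functional:
  fixes d :: "'a::real_normed_vector"
  obtains l where "linear l" "\<And>x. l x \<le> norm x" "l d = norm d"
proof -
  have norm: "sublinear (norm :: 'a \<Rightarrow> real)"
    by (auto simp: sublinear_def norm_triangle_ineq)
  obtain l where l: "sublinear l" "l \<le> shrink_along d norm"
    and min: "\<And>q'. sublinear q' \<Longrightarrow> q' \<le> l \<Longrightarrow> q' = l"
    using minimal_sublinear_exists[OF sublinear_shrink_along[OF norm]] by metis
  have lin: "linear l"
    by (rule minimal_sublinear_linear[OF l(1) min])
  have le: "l x \<le> norm x" for x
    using l(2) shrink_along_le[OF norm, of 0 d x] by (auto simp: le_fun_def intro: order_trans)
  have "l (- d) \<le> - norm d"
    using l(2) shrink_along_le[OF norm, of 1 d "- d"] by (auto simp: le_fun_def intro: order_trans)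
  then have "l d = norm d"
    using le[of d] by (simp add: linear_neg[OF lin])
  then show thesis
    using that lin le by blast
qed

lemma scaleC_of_real: "complex_of_real r *\<^sub>C x = r *\<^sub>R x"
  by (simp add: scaleR_scaleC)

lemma cdual_of_bounded_linear:
  assumes "bounded_linear F" "\<And>c x. F (c *\<^sub>C x) = c * F x"
  obtains D where "cdual_apply D = F"
proof
  show "cdual_apply (Abs_cdual (Blinfun F)) = F"
    using assms by (simp add: cdual_apply.rep_eq Abs_cdual_inverse bounded_linear_Blinfun_apply)
qed

lemma norm_cdual_apply_le: "cmod (cdual_apply \<phi> x) \<le> norm \<phi> * norm x"
  by transfer (rule norm_blinfun)

lemma norm_cdual_bound:
  assumes "0 \<le> K" "\<And>x. cmod (cdual_apply \<phi> x) \<le> K * norm x"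
  shows "norm \<phi> \<le> K"
  using assms by transfer (rule norm_blinfun_bound)

lemma bounded_linear_cdual_apply: "bounded_linear (cdual_apply \<phi>)"
  by transfer (rule blinfun.bounded_linear_right)

lemma cdual_apply_scaleC: "cdual_apply \<phi> (c *\<^sub>C x) = c * cdual_apply \<phi> x"
  by transfer simp

lemma cdual_apply_linear_simps:
  "cdual_apply \<phi> (x + y) = cdual_apply \<phi> x + cdual_apply \<phi> y"
  "cdual_apply \<phi> (x - y) = cdual_apply \<phi> x - cdual_apply \<phi> y"
  "cdual_apply \<phi> (r *\<^sub>R x) = r *\<^sub>R cdual_apply \<phi> x"
  "cdual_apply \<phi> 0 = 0"
  by (transfer, simp add: blinfun.bilinear_simps)+

text \<open>The complexification \<open>x \<mapsto> l x - \<i> l (\<i> x)\<close> of a real functional \<open>l\<close> is complex linear with the same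
  bound, as one sees by rotating \<open>x\<close> until the value is a nonnegative real. At \<open>d\<close> its real part already
  exhausts the bound, so the imaginary part vanishes.\<close>

theorem norming_functional:
  fixes d :: "'a::complex_normed_vector"
  obtains \<phi> where "norm \<phi> \<le> 1" "cdual_apply \<phi> d = complex_of_real (norm d)"
proof -
  obtain l where l: "linear l" "\<And>x. l x \<le> norm x" "l d = norm d"
    using real_norming_functional by blast
  define F where "F x = Complex (l x) (- l (\<i> *\<^sub>C x))" for x
  have ii: "\<i> *\<^sub>C (\<i> *\<^sub>C x) = - x" for x :: 'a
    using scaleC_of_real[of "-1" x] by (simp add: scaleC_scaleC)
  have split: "c *\<^sub>C x = Re c *\<^sub>R x + Im c *\<^sub>R (\<i> *\<^sub>C x)" for c and x :: 'a
  proof -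
    have "c *\<^sub>C x = (of_real (Re c) + of_real (Im c) * \<i>) *\<^sub>C x"
      by (simp add: complex_eq[symmetric] mult.commute[of _ \<i>])
    then show ?thesis
      by (simp only: scaleC_add_left scaleC_scaleC[symmetric] scaleC_of_real)
  qed
  have lin: "l (x + y) = l x + l y" "l (r *\<^sub>R x) = r * l x" "l (- x) = - l x" for x y r
    using l(1) by (auto simp: linear_add linear_scale linear_neg)
  have hom: "F (c *\<^sub>C x) = c * F x" for c x
  proof -
    have "\<i> *\<^sub>C (c *\<^sub>C x) = c *\<^sub>C (\<i> *\<^sub>C x)"
      by (simp only: scaleC_scaleC mult.commute)
    also have "\<dots> = Re c *\<^sub>R (\<i> *\<^sub>C x) + Im c *\<^sub>R (- x)"
      by (simp only: split[of c "\<i> *\<^sub>C x"] ii)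
    finally have "\<i> *\<^sub>C (c *\<^sub>C x) = Re c *\<^sub>R (\<i> *\<^sub>C x) + Im c *\<^sub>R (- x)" .
    then show ?thesis
      by (simp only: F_def split[of c x] lin) (simp add: complex_eq_iff algebra_simps)
  qed
  have bound: "cmod (F x) \<le> norm x" for x
  proof (cases "F x = 0")
    case False
    define c where "c = cnj (sgn (F x))"
    have "F x * cnj (F x) = complex_of_real (cmod (F x)) * complex_of_real (cmod (F x))"
      by (simp add: complex_norm_square[symmetric] power2_eq_square[symmetric])
    then have c: "c * F x = cmod (F x)" "cmod c = 1"
      using False by (simp_all add: c_def norm_sgn sgn_div_norm norm_divide scaleR_conv_of_real field_simps)
    then have "cmod (F x) = Re (F (c *\<^sub>C x))"
      by (simp add: hom)
    also have "\<dots> = l (c *\<^sub>C x)"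
      by (simp add: F_def)
    also have "\<dots> \<le> norm (c *\<^sub>C x)"
      by (rule l(2))
    also have "\<dots> = norm x"
      by (simp add: norm_scaleC c)
    finally show ?thesis .
  qed simp
  have "bounded_linear F"
  proof (rule bounded_linear_intro[where K = 1])
    show "F (x + y) = F x + F y" for x y
      by (simp add: F_def scaleC_add_right lin complex_eq_iff)
    show "F (r *\<^sub>R x) = r *\<^sub>R F x" for r x
      using hom[of "of_real r" x] by (simp add: scaleC_of_real scaleR_conv_of_real)
  qed (simp add: bound)
  then obtain D where D: "cdual_apply D = F"
    using cdual_of_bounded_linear hom by blast
  have "norm D \<le> 1"
    by (rule norm_cdual_bound) (auto simp: D bound)
  moreover have "F d = norm d"
  proof -
    have "Re (F d) = norm d"
      by (simp add: F_def l)
    moreover from this have "Im (F d) = 0"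
      using bound[of d] cmod_power2[of "F d"] power_mono[OF bound[of d], of 2] by simp
    ultimately show ?thesis
      by (simp add: complex_eq_iff)
  qed
  ultimately show thesis
    using that D by simp
qed

section \<open>Goldstine's theorem and common kernels\<close>

lemma norm_le_of_Re_bound:
  assumes "\<And>y. y \<in> ball 0 1 \<Longrightarrow> - K \<le> Re (cdual_apply \<psi> y)"
  shows "norm \<psi> \<le> K"
proof (rule norm_cdual_bound)
  show "0 \<le> K"
    using assms[of 0] by (simp add: cdual_apply_linear_simps)
  fix x
  show "cmod (cdual_apply \<psi> x) \<le> K * norm x"
  proof (cases "cdual_apply \<psi> x = 0 \<or> x = 0")
    case True
    then show ?thesis
      using \<open>0 \<le> K\<close> by (auto simp: cdual_apply_linear_simps)
  next
    case False
    define w where "w = cdual_apply \<psi> x"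
    define c where "c = - cnj w / of_real (cmod w * norm x)"
    have w: "w \<noteq> 0" "x \<noteq> 0"
      using False by (auto simp: w_def)
    have cw: "c * w = - of_real (cmod w / norm x)"
    proof -
      have "cnj w * w = of_real (cmod w) * of_real (cmod w)"
        by (simp add: complex_norm_square[symmetric] power2_eq_square[symmetric] mult.commute[of "cnj w"])
      then show ?thesis
        using w by (simp add: c_def field_simps)
    qed
    have norm_c: "norm (c *\<^sub>C x) = 1"
      using w by (simp add: norm_scaleC c_def norm_divide norm_mult)
    have "t * (cmod w / norm x) \<le> K" if "t < 1" "0 \<le> t" for t
    proof -
      have "- K \<le> Re (cdual_apply \<psi> (t *\<^sub>R (c *\<^sub>C x)))"
        using that by (intro assms) (simp add: norm_c)
      also have "\<dots> = - (t * (cmod w / norm x))"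
        by (simp add: cdual_apply_linear_simps cdual_apply_scaleC cw flip: w_def)
      finally show ?thesis
        by simp
    qed
    then have "cmod w / norm x \<le> K"
      using field_le_mult_one_interval[of "cmod w / norm x" K] by (simp add: less_imp_le)
    then show ?thesis
      using w by (simp add: w_def field_simps)
  qed
qed

lemma cdual_apply_sum_left:
  "finite A \<Longrightarrow> cdual_apply (\<Sum>i\<in>A. \<Phi> i) x = (\<Sum>i\<in>A. cdual_apply (\<Phi> i) x)"
  by (rule linear_sum[OF bounded_linear.linear[OF bounded_linear_cdual_apply_left]])

lemma cdual_apply_sum_right:
  "finite A \<Longrightarrow> cdual_apply \<phi> (\<Sum>i\<in>A. f i) = (\<Sum>i\<in>A. cdual_apply \<phi> (f i))"
  by (rule linear_sum[OF bounded_linear.linear[OF bounded_linear_cdual_apply]])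

text \<open>Let \<open>x\<close> nearly minimise \<open>F x\<close>, the squared distance of the vectors with entries \<open>\<phi> x\<close> and \<open>z \<phi>\<close> for
  \<open>\<phi> \<in> A\<close>, over the ball. The functional \<open>\<psi>\<close> obtained by linearising \<open>F\<close> at \<open>x\<close> satisfies
  \<open>F x = Re (\<psi> x) - Re (z \<psi>)\<close>. Near-minimality says that \<open>Re \<psi>\<close> on the ball is nearly bounded below by
  \<open>Re (\<psi> x)\<close>, so \<open>norm \<psi>\<close> is at most about \<open>- Re (\<psi> x)\<close>, while \<open>- Re (z \<psi>) \<le> norm \<psi>\<close>. Adding up,
  the infimum of \<open>F\<close> is as small as one likes. Near-minimisers take the place of the compactness argument in the
  usual separation of a point from a closed convex set.\<close>

theorem goldstine:
  fixes z :: "'a::complex_normed_vector cdual cdual"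
  assumes z: "norm z \<le> 1" and A: "finite A" and e: "0 < e"
  obtains x where "x \<in> ball 0 1" "\<And>\<phi>. \<phi> \<in> A \<Longrightarrow> cmod (cdual_apply \<phi> x - cdual_apply z \<phi>) < e"
proof -
  define F where "F x = (\<Sum>\<phi>\<in>A. (cmod (cdual_apply \<phi> x - cdual_apply z \<phi>))\<^sup>2)" for x
  define m where "m = (INF x\<in>ball 0 1. F x)"
  define C where "C = (\<Sum>\<phi>\<in>A. (2 * norm \<phi>)\<^sup>2)"
  have F0: "0 \<le> F x" for x
    by (simp add: F_def sum_nonneg)
  have bdd: "bdd_below (F ` ball 0 1)"
    using F0 by (intro bdd_belowI2)
  have m_le: "m \<le> F x" if "x \<in> ball 0 1" for x
    unfolding m_def using that by (intro cINF_lower bdd)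
  have C0: "0 \<le> C"
    by (simp add: C_def sum_nonneg)
  \<comment> \<open>\<open>x\<close> is moved by the fraction \<open>t\<close> towards another point of the ball; it is chosen to be optimal up to \<open>t\<^sup>2\<close>,
    the order of the quadratic error term.\<close>
  have "m \<le> 2 * t * (1 + C)" if t: "0 < t" "t < 1" for t
  proof -
    have "\<exists>x\<in>ball 0 1. F x < m + t\<^sup>2"
      using cINF_less_iff[OF _ bdd, of "m + t\<^sup>2"] t by (simp add: m_def)
    then obtain x where x: "x \<in> ball 0 1" "F x < m + t\<^sup>2"
      by blast
    define a where "a \<phi> = cdual_apply \<phi> x - cdual_apply z \<phi>" for \<phi>
    define \<psi> where "\<psi> = (\<Sum>\<phi>\<in>A. cnj (a \<phi>) *\<^sub>C \<phi>)"
    have \<psi>: "cdual_apply \<psi> y = (\<Sum>\<phi>\<in>A. cnj (a \<phi>) * cdual_apply \<phi> y)" for y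
      by (simp add: \<psi>_def cdual_apply_sum_left A cdual_apply_scaleC_left)
    have z\<psi>: "cdual_apply z \<psi> = (\<Sum>\<phi>\<in>A. cnj (a \<phi>) * cdual_apply z \<phi>)"
      by (simp add: \<psi>_def cdual_apply_sum_right A cdual_apply_scaleC)
    have Fx: "F x = Re (cdual_apply \<psi> x) - Re (cdual_apply z \<psi>)"
    proof -
      have "complex_of_real (F x) = (\<Sum>\<phi>\<in>A. cnj (a \<phi>) * a \<phi>)"
        by (simp only: F_def of_real_sum complex_norm_square a_def mult.commute[of "cnj _"])
      also have "\<dots> = cdual_apply \<psi> x - cdual_apply z \<psi>"
        by (simp add: \<psi> z\<psi> a_def right_diff_distrib sum_subtractf)
      finally show ?thesis
        by (metis Re_complex_of_real minus_complex.sel(1))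
    qed
    have "- (norm \<psi> - m + t * (1 + C)) \<le> Re (cdual_apply \<psi> y)" if y: "y \<in> ball 0 1" for y
    proof -
      define b where "b \<phi> = cdual_apply \<phi> (y - x)" for \<phi>
      have "x + t *\<^sub>R (y - x) = (1 - t) *\<^sub>R x + t *\<^sub>R y"
        by (simp add: algebra_simps)
      also have "\<dots> \<in> ball 0 1"
        using x(1) y t by (intro convexD[OF convex_ball]) auto
      finally have "m \<le> F (x + t *\<^sub>R (y - x))"
        by (rule m_le)
      also have "\<dots> = (\<Sum>\<phi>\<in>A. (cmod (a \<phi> + t *\<^sub>R b \<phi>))\<^sup>2)"
        by (simp add: F_def a_def b_def cdual_apply_linear_simps algebra_simps)
      also have "\<dots> = (\<Sum>\<phi>\<in>A. (cmod (a \<phi>))\<^sup>2 + 2 * t * Re (cnj (a \<phi>) * b \<phi>) + t\<^sup>2 * (cmod (b \<phi>))\<^sup>2)"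
        by (intro sum.cong refl) (simp add: cmod_power2, simp add: power2_eq_square algebra_simps)
      also have "\<dots> = F x + 2 * t * (\<Sum>\<phi>\<in>A. Re (cnj (a \<phi>) * b \<phi>)) + t\<^sup>2 * (\<Sum>\<phi>\<in>A. (cmod (b \<phi>))\<^sup>2)"
        by (simp add: sum.distrib sum_distrib_left F_def a_def)
      also have "(\<Sum>\<phi>\<in>A. Re (cnj (a \<phi>) * b \<phi>)) = Re (cdual_apply \<psi> (y - x))"
        by (simp only: \<psi> b_def Re_sum)
      also have "t\<^sup>2 * (\<Sum>\<phi>\<in>A. (cmod (b \<phi>))\<^sup>2) \<le> t\<^sup>2 * C"
      proof -
        have "cmod (b \<phi>) \<le> 2 * norm \<phi>" for \<phi>
        proof -
          have "norm (y - x) \<le> 2"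
            using x(1) y norm_triangle_ineq4[of y x] by simp
          then have "norm \<phi> * norm (y - x) \<le> norm \<phi> * 2"
            by (rule mult_left_mono) simp
          then show ?thesis
            using norm_cdual_apply_le[of \<phi> "y - x"] by (simp add: b_def)
        qed
        then show ?thesis
          unfolding C_def by (intro mult_left_mono sum_mono power_mono) auto
      qed
      finally have "m \<le> F x + 2 * t * Re (cdual_apply \<psi> (y - x)) + t\<^sup>2 * C"
        by simp
      then have "0 \<le> t * (t * (1 + C) + 2 * Re (cdual_apply \<psi> (y - x)))"
        using x(2) by (simp add: algebra_simps power2_eq_square)
      then have "0 \<le> t * (1 + C) + 2 * Re (cdual_apply \<psi> (y - x))"
        using t by (simp add: zero_le_mult_iff)
      moreover have "0 \<le> t * (1 + C)"
        using t C0 by simp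
      moreover have "m \<le> F x"
        by (rule m_le[OF x(1)])
      moreover have "- norm \<psi> \<le> Re (cdual_apply z \<psi>)"
      proof -
        have "cmod (cdual_apply z \<psi>) \<le> norm z * norm \<psi>"
          by (rule norm_cdual_apply_le)
        also have "\<dots> \<le> norm \<psi>"
          using z by (simp add: mult_left_le_one_le)
        finally show ?thesis
          using abs_Re_le_cmod[of "cdual_apply z \<psi>"] by linarith
      qed
      ultimately show ?thesis
        using Fx by (simp add: cdual_apply_linear_simps)
    qed
    then have "norm \<psi> \<le> norm \<psi> - m + t * (1 + C)"
      by (rule norm_le_of_Re_bound)
    moreover have "0 \<le> t * (1 + C)"
      using t C0 by simp
    ultimately show ?thesis
      by simp
  qed
  note m_small = this
  have "\<not> e\<^sup>2 \<le> m"
  proof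
    assume m: "e\<^sup>2 \<le> m"
    define t where "t = min (1/2) (e\<^sup>2 / (4 * (1 + C)))"
    have t: "0 < t" "t < 1" "2 * t * (1 + C) \<le> e\<^sup>2 / 2"
    proof -
      show "0 < t" "t < 1"
        using C0 e by (auto simp: t_def)
      have "t * (1 + C) \<le> (e\<^sup>2 / (4 * (1 + C))) * (1 + C)"
        using C0 by (intro mult_right_mono) (auto simp: t_def)
      also have "\<dots> = e\<^sup>2 / 4"
        using C0 by (simp add: field_simps)
      finally show "2 * t * (1 + C) \<le> e\<^sup>2 / 2"
        by simp
    qed
    have "0 < e\<^sup>2"
      using e by simp
    then show False
      using m_small[OF t(1,2)] t(3) m by linarith
  qed
  then have "\<exists>x\<in>ball 0 1. F x < e\<^sup>2"
    using cINF_less_iff[OF _ bdd, of "e\<^sup>2"] by (simp add: m_def)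
  then obtain x where x: "x \<in> ball 0 1" "F x < e\<^sup>2"
    by blast
  have "cmod (cdual_apply \<phi> x - cdual_apply z \<phi>) < e" if "\<phi> \<in> A" for \<phi>
  proof -
    have "(cmod (cdual_apply \<phi> x - cdual_apply z \<phi>))\<^sup>2 \<le> F x"
      unfolding F_def using A that by (intro member_le_sum) auto
    then have "(cmod (cdual_apply \<phi> x - cdual_apply z \<phi>))\<^sup>2 < e\<^sup>2"
      using x(2) by simp
    then show ?thesis
      using e by (simp add: power_less_imp_less_base)
  qed
  then show thesis
    using that x(1) by blast
qed

text \<open>By induction: a further functional either vanishes on the previous common kernel, or a vector of that kernel on
  which it does not vanish completes the spanning set of a complement.\<close>

lemma finite_codimension_kernels:
  fixes A :: "'a::complex_normed_vector cdual set"
  assumes "finite A"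
  shows "\<exists>S. finite S \<and> (\<forall>x. \<exists>s\<in>complex_vector.span S. \<forall>\<phi>\<in>A. cdual_apply \<phi> (x - s) = 0)"
  using assms
proof (induction A)
  case empty
  show ?case
    by (auto intro!: exI[of _ "{}"])
next
  case (insert \<phi> A)
  from insert.IH obtain S where S: "finite S"
    "\<And>x. \<exists>s\<in>complex_vector.span S. \<forall>\<phi>\<in>A. cdual_apply \<phi> (x - s) = 0"
    by metis
  show ?case
  proof (cases "\<exists>k. (\<forall>\<phi>\<in>A. cdual_apply \<phi> k = 0) \<and> cdual_apply \<phi> k \<noteq> 0")
    case False
    then show ?thesis
      using S by (intro exI[of _ S]) blast
  next
    case True
    then obtain k where k: "\<And>\<phi>. \<phi> \<in> A \<Longrightarrow> cdual_apply \<phi> k = 0" "cdual_apply \<phi> k \<noteq> 0"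
      by blast
    have "\<exists>s\<in>complex_vector.span (insert k S). \<forall>\<phi>'\<in>insert \<phi> A. cdual_apply \<phi>' (x - s) = 0" for x
    proof -
      obtain s where s: "s \<in> complex_vector.span S" "\<And>\<phi>. \<phi> \<in> A \<Longrightarrow> cdual_apply \<phi> (x - s) = 0"
        using S(2) by blast
      define c where "c = cdual_apply \<phi> (x - s) / cdual_apply \<phi> k"
      have "s + c *\<^sub>C k \<in> complex_vector.span (insert k S)"
        using subsetD[OF complex_vector.span_mono[OF subset_insertI] s(1)]
        by (intro complex_vector.span_add complex_vector.span_scale) (auto intro: complex_vector.span_base)
      moreover have "cdual_apply \<phi>' (x - (s + c *\<^sub>C k)) = cdual_apply \<phi>' (x - s) - c * cdual_apply \<phi>' k" for \<phi>'
        by (simp add: cdual_apply_linear_simps cdual_apply_scaleC)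
      ultimately show ?thesis
        using s(2) k by (intro bexI[of _ "s + c *\<^sub>C k"]) (auto simp: c_def)
    qed
    then show ?thesis
      using S(1) by (intro exI[of _ "insert k S"]) auto
  qed
qed

lemma common_kernel_nontrivial:
  fixes A :: "'a::complex_normed_vector cdual set"
  assumes infinite_dim: "\<nexists>S :: 'a set. finite S \<and> complex_vector.span S = UNIV" and "finite A"
  obtains y :: 'a where "y \<noteq> 0" "\<And>\<phi>. \<phi> \<in> A \<Longrightarrow> cdual_apply \<phi> y = 0"
proof -
  obtain S where S: "finite S"
    "\<And>x. \<exists>s\<in>complex_vector.span S. \<forall>\<phi>\<in>A. cdual_apply \<phi> (x - s) = 0"
    using finite_codimension_kernels[OF \<open>finite A\<close>] by metis
  obtain x where x: "x \<notin> complex_vector.span S"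
    using infinite_dim S(1) by blast
  obtain s where "s \<in> complex_vector.span S" "\<forall>\<phi>\<in>A. cdual_apply \<phi> (x - s) = 0"
    using S(2) by blast
  with x show thesis
    by (intro that[of "x - s"]) auto
qed

section \<open>A criterion for cluster values\<close>

text \<open>The sets of points approximating to precision \<open>e\<close> on a finite set \<open>A\<close> of functionals form a filter
  base, and the filter they generate witnesses the cluster value.\<close>

lemma cluster_setI:
  fixes z :: "'a::complex_normed_vector cdual cdual"
  assumes approx: "\<And>A e. finite A \<Longrightarrow> 0 < e \<Longrightarrow> \<exists>x\<in>ball 0 1.
      (\<forall>\<phi>\<in>A. cmod (cdual_apply \<phi> x - cdual_apply z \<phi>) < e) \<and> cmod (f x - l) < e"
  shows "l \<in> cluster_set f z"
proof -
  define N where "N = (\<lambda>(A, e). {x \<in> ball 0 1.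
      (\<forall>\<phi>\<in>A. cmod (cdual_apply \<phi> x - cdual_apply z \<phi>) < e) \<and> cmod (f x - l) < e})"
  define I where "I = {A :: 'a cdual set. finite A} \<times> {0::real<..}"
  define F where "F = (INF i\<in>I. principal (N i))"
  have ev: "eventually P F \<longleftrightarrow> (\<exists>i\<in>I. \<forall>x\<in>N i. P x)" for P
  proof -
    have "eventually P F \<longleftrightarrow> (\<exists>i\<in>I. eventually P (principal (N i)))"
      unfolding F_def
    proof (rule eventually_INF_base)
      show "I \<noteq> {}"
        by (auto simp: I_def intro!: exI[of _ 1])
      fix i j assume "i \<in> I" "j \<in> I"
      then show "\<exists>k\<in>I. principal (N k) \<le> inf (principal (N i)) (principal (N j))"
        by (intro bexI[of _ "(fst i \<union> fst j, min (snd i) (snd j))"]) (auto simp: I_def N_def)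
    qed
    then show ?thesis
      by (auto simp: eventually_principal)
  qed
  have evI: "eventually P F" if "finite A" "0 < e" "\<And>x. x \<in> N (A, e) \<Longrightarrow> P x" for P A e
    unfolding ev using that by (intro bexI[of _ "(A, e)"]) (auto simp: I_def)
  have "N (A, e) \<noteq> {}" if "finite A" "0 < e" for A e
    using approx[OF that] by (auto simp: N_def)
  then have "F \<noteq> bot"
    by (auto simp: trivial_limit_def ev I_def)
  moreover have "\<forall>\<^sub>F x in F. x \<in> ball 0 1"
    by (rule evI[of "{}" 1]) (auto simp: N_def)
  moreover have "limitin weak_star_topology bidual_embedding z F"
    unfolding limitin_weak_star cdual_apply_bidual_embedding
  proof (intro allI tendstoI)
    fix \<phi> and e :: real assume "0 < e"
    then show "\<forall>\<^sub>F x in F. dist (cdual_apply \<phi> x) (cdual_apply z \<phi>) < e"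
      by (intro evI[of "{\<phi>}" e]) (auto simp: N_def dist_norm)
  qed
  moreover have "(f \<longlongrightarrow> l) F"
  proof (rule tendstoI)
    fix e :: real assume "0 < e"
    then show "\<forall>\<^sub>F x in F. dist (f x) l < e"
      by (intro evI[of "{}" e]) (auto simp: N_def dist_norm)
  qed
  ultimately show ?thesis
    by (auto simp: cluster_set_def)
qed

section \<open>A sum of logarithms of functionals\<close>

lemma cdual_derivative_chain:
  assumes "(f has_derivative cdual_apply D) (at x)" "(h has_field_derivative h') (at (f x))"
  shows "((\<lambda>x. h (f x)) has_derivative cdual_apply (h' *\<^sub>C D)) (at x)"
proof -
  have "((\<lambda>x. h (f x)) has_derivative (\<lambda>k. h' * cdual_apply D k)) (at x)"
    using has_derivative_compose[OF assms(1), of h "(*) h'"] assms(2)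
    by (simp add: has_field_derivative_def)
  then show ?thesis
    by (simp add: cdual_apply_scaleC_left[abs_def])
qed

text \<open>In the application the \<open>\<phi> n\<close> are norming functionals of a dense sequence. The argument of each logarithm lies in
  the open right half-plane and in the unit disk, so the sum stays in the half-strip of
  nonpositive real part and imaginary part at most \<open>pi\<close>, and its real part tends to minus infinity wherever one
  \<open>\<phi> n\<close> tends to \<open>1\<close>.\<close>

definition log_sum :: "(nat \<Rightarrow> 'a::complex_normed_vector cdual) \<Rightarrow> 'a \<Rightarrow> complex" where
  "log_sum \<phi> x = suminf (\<lambda>n. (1 / 2) ^ n * Ln ((1 - cdual_apply (\<phi> n) x) / 2))"

context
  fixes \<phi> :: "nat \<Rightarrow> 'a::complex_normed_vector cdual"
  assumes norm_le: "\<And>n. norm (\<phi> n) \<le> 1"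
begin

lemma cmod_functional_le: "cmod (cdual_apply (\<phi> n) x) \<le> norm x"
proof -
  have "norm (\<phi> n) * norm x \<le> 1 * norm x"
    by (intro mult_right_mono norm_le) simp
  then show ?thesis
    using norm_cdual_apply_le[of "\<phi> n" x] by simp
qed

lemma Re_functional_less:
  assumes "x \<in> ball 0 1"
  shows "0 < Re (1 - cdual_apply (\<phi> n) x)"
  using assms cmod_functional_le[of n x] complex_Re_le_cmod[of "cdual_apply (\<phi> n) x"] by simp

text \<open>On a ball of radius \<open>R < 1\<close> the derivatives of the terms are dominated by \<open>(1 / 2) ^ n / (1 - R)\<close>, so the series may be
  differentiated termwise. Convergence of the series itself then needs checking only at the origin.\<close>

lemma log_series_termwise_derivative:
  assumes R: "0 < R" "R < 1"
  shows "\<exists>g. \<forall>x\<in>ball 0 R. (\<lambda>n. (1 / 2) ^ n * Ln ((1 - cdual_apply (\<phi> n) x) / 2)) sums g x \<and>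
    (g has_derivative (\<lambda>h. suminf (\<lambda>n. - ((1 / 2) ^ n * cdual_apply (\<phi> n) h / (1 - cdual_apply (\<phi> n) x)))))
      (at x within ball 0 R)"
    and "x \<in> ball 0 R \<Longrightarrow> summable (\<lambda>n. - ((1 / 2) ^ n * cdual_apply (\<phi> n) h / (1 - cdual_apply (\<phi> n) x)))"
proof -
  define f' where "f' n x h = - ((1 / 2) ^ n * cdual_apply (\<phi> n) h / (1 - cdual_apply (\<phi> n) x))" for n x h
  have bound: "cmod (f' n x h) \<le> (1 / 2) ^ n * (norm h / (1 - R))" if x: "x \<in> ball 0 R" for n x h
  proof -
    have "1 - R \<le> cmod (1 - cdual_apply (\<phi> n) x)"
      using x cmod_functional_le[of n x] norm_triangle_ineq2[of 1 "cdual_apply (\<phi> n) x"] by simp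
    then have "cmod (cdual_apply (\<phi> n) h) / cmod (1 - cdual_apply (\<phi> n) x) \<le> norm h / (1 - R)"
      using R by (intro frac_le cmod_functional_le) auto
    from mult_left_mono[OF this, of "(1 / 2) ^ n"] show ?thesis
      by (simp add: f'_def norm_mult norm_divide norm_power)
  qed
  have geom: "summable (\<lambda>n. (1 / 2) ^ n * (c::real))" for c
    by (intro summable_mult2 summable_geometric) simp
  have norm_summable: "summable (\<lambda>n. cmod (f' n x h))" if "x \<in> ball 0 R" for x h
    by (rule summable_comparison_test[OF _ geom[of "norm h / (1 - R)"]])
      (use bound[OF that] in auto)
  have summable: "summable (\<lambda>n. f' n x h)" if "x \<in> ball 0 R" for x h
    using norm_summable[OF that] by (rule summable_norm_cancel)
  show "x \<in> ball 0 R \<Longrightarrow> summable (\<lambda>n. - ((1 / 2) ^ n * cdual_apply (\<phi> n) h / (1 - cdual_apply (\<phi> n) x)))"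
    using summable[of x h] by (simp add: f'_def)
  have tail: "cmod ((\<Sum>i<n. f' i x h) - (suminf (\<lambda>i. f' i x h))) \<le> (2 * (1 / 2) ^ n / (1 - R)) * norm h"
    if x: "x \<in> ball 0 R" for n x h
  proof -
    have "cmod ((\<Sum>i<n. f' i x h) - (suminf (\<lambda>i. f' i x h))) = cmod (suminf (\<lambda>i. f' (i + n) x h))"
      using suminf_minus_initial_segment[OF summable[OF x], of n h] by (simp add: norm_minus_commute)
    also have "\<dots> \<le> (suminf (\<lambda>i. cmod (f' (i + n) x h)))"
      using norm_summable[OF x, of h] by (intro summable_norm) (simp add: summable_iff_shift[of "\<lambda>i. cmod (f' i x h)"])
    also have "\<dots> \<le> (suminf (\<lambda>i. (1 / 2) ^ i * ((1 / 2) ^ n * (norm h / (1 - R)))))"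
    proof (intro suminf_le geom)
      show "summable (\<lambda>i. cmod (f' (i + n) x h))"
        using norm_summable[OF x, of h] by (simp add: summable_iff_shift[of "\<lambda>i. cmod (f' i x h)"])
      show "cmod (f' (i + n) x h) \<le> (1 / 2) ^ i * ((1 / 2) ^ n * (norm h / (1 - R)))" for i
        using bound[OF x, of "i + n" h] by (simp add: power_add mult.assoc)
    qed
    also have "\<dots> = 2 * ((1 / 2) ^ n * (norm h / (1 - R)))"
      using suminf_mult2[OF summable_geometric[of "1/2::real"], of "(1 / 2) ^ n * (norm h / (1 - R))"]
      by (simp add: suminf_geometric)
    finally show ?thesis
      by simp
  qed
  have "\<exists>g. \<forall>x\<in>ball 0 R. (\<lambda>n. (1 / 2) ^ n * Ln ((1 - cdual_apply (\<phi> n) x) / 2)) sums g x \<and>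
      (g has_derivative (\<lambda>h. suminf (\<lambda>n. f' n x h))) (at x within ball 0 R)"
  proof (rule has_derivative_series[where f' = f' and x = 0])
    fix n and x :: 'a assume x: "x \<in> ball 0 R"
    have pos: "0 < Re (1 - cdual_apply (\<phi> n) x)"
      using x R by (intro Re_functional_less) auto
    then have ne: "(1 - cdual_apply (\<phi> n) x) / 2 \<notin> \<real>\<^sub>\<le>\<^sub>0"
      by (auto simp: complex_nonpos_Reals_iff)
    have "((\<lambda>w. (1 / 2) ^ n * Ln ((1 - w) / 2)) has_field_derivative
        - ((1 / 2) ^ n / (1 - cdual_apply (\<phi> n) x))) (at (cdual_apply (\<phi> n) x))"
      using ne pos by (auto intro!: derivative_eq_intros simp: divide_simps)
    moreover have "(cdual_apply (\<phi> n) has_derivative cdual_apply (\<phi> n)) (at x)"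
      by (rule bounded_linear_imp_has_derivative[OF bounded_linear_cdual_apply])
    ultimately have "((\<lambda>x. (1 / 2) ^ n * Ln ((1 - cdual_apply (\<phi> n) x) / 2)) has_derivative
        cdual_apply (- ((1 / 2) ^ n / (1 - cdual_apply (\<phi> n) x)) *\<^sub>C \<phi> n)) (at x)"
      by (rule cdual_derivative_chain[rotated])
    moreover have "cdual_apply (- ((1 / 2) ^ n / (1 - cdual_apply (\<phi> n) x)) *\<^sub>C \<phi> n) = f' n x"
      by (rule ext, subst cdual_apply_scaleC_left) (simp add: f'_def)
    ultimately show "((\<lambda>x. (1 / 2) ^ n * Ln ((1 - cdual_apply (\<phi> n) x) / 2)) has_derivative f' n x)
        (at x within ball 0 R)"
      by (simp add: has_derivative_at_withinI)
  next
    fix e :: real assume e: "0 < e"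
    have "(\<lambda>n. 2 * (1 / 2) ^ n / (1 - R)) \<longlonglongrightarrow> 2 * 0 / (1 - R)"
      using R by (intro tendsto_intros LIMSEQ_realpow_zero) auto
    then have "\<forall>\<^sub>F n in sequentially. 2 * (1 / 2) ^ n / (1 - R) < e"
      using e by (intro order_tendstoD(2)) auto
    then show "\<forall>\<^sub>F n in sequentially. \<forall>x\<in>ball 0 R. \<forall>h.
        cmod ((\<Sum>i<n. f' i x h) - (suminf (\<lambda>i. f' i x h))) \<le> e * norm h"
    proof eventually_elim
      case (elim n)
      show ?case
      proof (intro ballI allI)
        fix x h :: 'a assume x: "x \<in> ball 0 R"
        note tail[OF x, where n = n and h = h]
        also have "2 * (1 / 2) ^ n / (1 - R) * norm h \<le> e * norm h"
          using elim by (intro mult_right_mono) auto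
        finally show "cmod ((\<Sum>i<n. f' i x h) - (suminf (\<lambda>i. f' i x h))) \<le> e * norm h" .
      qed
    qed
  next
    show "(\<lambda>n. (1 / 2) ^ n * Ln ((1 - cdual_apply (\<phi> n) 0) / 2)) sums (2 * Ln (1 / 2))"
      using sums_mult2[OF geometric_sums[of "1/2::complex"], of "Ln (1/2)"]
      by (simp add: cdual_apply_linear_simps norm_divide)
  qed (use R in auto)
  then show "\<exists>g. \<forall>x\<in>ball 0 R. (\<lambda>n. (1 / 2) ^ n * Ln ((1 - cdual_apply (\<phi> n) x) / 2)) sums g x \<and>
    (g has_derivative (\<lambda>h. suminf (\<lambda>n. - ((1 / 2) ^ n * cdual_apply (\<phi> n) h / (1 - cdual_apply (\<phi> n) x)))))
      (at x within ball 0 R)"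
    by (simp add: f'_def)
qed

lemma log_sum_holomorphic:
  assumes x: "x \<in> ball 0 1"
  shows log_sum_sums: "(\<lambda>n. (1 / 2) ^ n * Ln ((1 - cdual_apply (\<phi> n) x) / 2)) sums log_sum \<phi> x"
    and log_sum_has_derivative: "\<exists>D. (log_sum \<phi> has_derivative cdual_apply D) (at x)"
proof -
  define R where "R = (1 + norm x) / 2"
  have R: "0 < R" "R < 1" "x \<in> ball 0 R"
    using x by (auto simp: R_def add_pos_nonneg)
  define F where "F h = (suminf (\<lambda>n. - ((1 / 2) ^ n * cdual_apply (\<phi> n) h / (1 - cdual_apply (\<phi> n) x))))" for h
  obtain g where "\<forall>y\<in>ball 0 R. (\<lambda>n. (1 / 2) ^ n * Ln ((1 - cdual_apply (\<phi> n) y) / 2)) sums g y \<and>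
      (g has_derivative (\<lambda>h. suminf (\<lambda>n. - ((1 / 2) ^ n * cdual_apply (\<phi> n) h / (1 - cdual_apply (\<phi> n) y)))))
        (at y within ball 0 R)"
    using log_series_termwise_derivative(1)[OF R(1,2)] by (elim exE)
  then have g: "\<And>y. y \<in> ball 0 R \<Longrightarrow> (\<lambda>n. (1 / 2) ^ n * Ln ((1 - cdual_apply (\<phi> n) y) / 2)) sums g y"
    and "(g has_derivative F) (at x within ball 0 R)"
    using R(3) by (auto simp: F_def[abs_def])
  then have g': "(g has_derivative F) (at x)"
    using R(3) by (simp add: at_within_open[of x "ball 0 R"])
  have eq: "g y = log_sum \<phi> y" if "y \<in> ball 0 R" for y
    unfolding log_sum_def using g[OF that] by (rule sums_unique)
  show "(\<lambda>n. (1 / 2) ^ n * Ln ((1 - cdual_apply (\<phi> n) x) / 2)) sums log_sum \<phi> x"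
    using g[OF R(3)] eq[OF R(3)] by simp
  have F: "(log_sum \<phi> has_derivative F) (at x)"
    by (rule has_derivative_transform_within_open[OF g' open_ball R(3)]) (rule eq)
  have "F (c *\<^sub>C h) = c * F h" for c h
  proof -
    have "(suminf (\<lambda>n. - ((1 / 2) ^ n * cdual_apply (\<phi> n) (c *\<^sub>C h) / (1 - cdual_apply (\<phi> n) x))))
        = (suminf (\<lambda>n. c * - ((1 / 2) ^ n * cdual_apply (\<phi> n) h / (1 - cdual_apply (\<phi> n) x))))"
      by (rule suminf_cong) (simp add: cdual_apply_scaleC)
    also have "\<dots> = c * (suminf (\<lambda>n. - ((1 / 2) ^ n * cdual_apply (\<phi> n) h / (1 - cdual_apply (\<phi> n) x))))"
      by (rule suminf_mult[OF log_series_termwise_derivative(2)[OF R]])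
    finally show ?thesis
      by (simp add: F_def)
  qed
  then obtain D where "cdual_apply D = F"
    using cdual_of_bounded_linear has_derivative_bounded_linear[OF F] by blast
  then show "\<exists>D. (log_sum \<phi> has_derivative cdual_apply D) (at x)"
    using F by blast
qed

lemma Re_log_term_nonpos:
  assumes "x \<in> ball 0 1"
  shows "Re (Ln ((1 - cdual_apply (\<phi> n) x) / 2)) \<le> 0"
proof -
  have "cmod (1 - cdual_apply (\<phi> n) x) \<le> 1 + cmod (cdual_apply (\<phi> n) x)"
    using norm_triangle_ineq4[of 1 "cdual_apply (\<phi> n) x"] by simp
  also have "\<dots> \<le> 2"
    using assms cmod_functional_le[of n x] by simp
  finally have "cmod ((1 - cdual_apply (\<phi> n) x) / 2) \<le> 1"
    by (simp add: norm_divide)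
  moreover have "1 - cdual_apply (\<phi> n) x \<noteq> 0"
    using Re_functional_less[OF assms, of n] by fastforce
  ultimately show ?thesis
    by simp
qed

text \<open>All terms have nonpositive real part, so each single one is an upper bound.\<close>

lemma Re_log_sum_le:
  assumes x: "x \<in> ball 0 1"
  shows "Re (log_sum \<phi> x) \<le> (1 / 2) ^ n * Re (Ln ((1 - cdual_apply (\<phi> n) x) / 2))"
proof -
  let ?f = "\<lambda>n. (1 / 2) ^ n * Re (Ln ((1 - cdual_apply (\<phi> n) x) / 2))"
  have "Re ((1 / 2) ^ n * w) = (1 / 2) ^ n * Re w" for n w
    using scaleR_complex.sel(1)[of "(1 / 2) ^ n" w] by (simp add: scaleR_conv_of_real)
  then have sums: "?f sums Re (log_sum \<phi> x)"
    using sums_Re[OF log_sum_sums[OF x]] by simp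
  then have "(\<lambda>n. - ?f n) sums - Re (log_sum \<phi> x)"
    by (rule sums_minus)
  moreover have "- ?f n \<le> (suminf (\<lambda>n. - ?f n))"
    using calculation Re_log_term_nonpos[OF x] sum_le_suminf[of "\<lambda>n. - ?f n" "{n}"]
    by (simp add: sums_iff mult_nonneg_nonpos)
  ultimately show ?thesis
    by (simp add: sums_iff)
qed

lemma Re_log_sum_nonpos: "x \<in> ball 0 1 \<Longrightarrow> Re (log_sum \<phi> x) \<le> 0"
  using Re_log_sum_le[of x 0] Re_log_term_nonpos[of x 0] by simp

lemma abs_Im_log_sum_le:
  assumes x: "x \<in> ball 0 1"
  shows "\<bar>Im (log_sum \<phi> x)\<bar> \<le> pi"
proof -
  let ?f = "\<lambda>n. (1 / 2) ^ n * Im (Ln ((1 - cdual_apply (\<phi> n) x) / 2))"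
  have "Im ((1 / 2) ^ n * w) = (1 / 2) ^ n * Im w" for n w
    using scaleR_complex.sel(2)[of "(1 / 2) ^ n" w] by (simp add: scaleR_conv_of_real)
  then have sums: "?f sums Im (log_sum \<phi> x)"
    using sums_Im[OF log_sum_sums[OF x]] by simp
  have geom: "(\<lambda>n. (1 / 2) ^ n * (pi / 2)) sums pi"
    using sums_mult2[OF geometric_sums[of "1/2::real"], of "pi / 2"] by simp
  have "\<bar>Im (Ln ((1 - cdual_apply (\<phi> n) x) / 2))\<bar> \<le> pi / 2" for n
    using Re_functional_less[OF x, of n] Re_Ln_pos_lt_imp[of "(1 - cdual_apply (\<phi> n) x) / 2"]
    by simp
  then have abs_le: "\<bar>?f n\<bar> \<le> (1 / 2) ^ n * (pi / 2)" for n
    by (simp add: abs_mult)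
  have "?f n \<le> (1 / 2) ^ n * (pi / 2)" "- ((1 / 2) ^ n * (pi / 2)) \<le> ?f n" for n
    using abs_le[of n] by linarith+
  then show ?thesis
    using sums_le[OF _ sums geom] sums_le[OF _ sums_minus[OF geom] sums] by (simp add: abs_le_iff)
qed

end

lemma isCont_log_sum:
  assumes "\<And>n. norm (\<phi> n) \<le> 1" "x \<in> ball 0 1"
  shows "isCont (log_sum \<phi>) x"
  using log_sum_has_derivative[of \<phi>, OF assms] has_derivative_continuous by blast

section \<open>Real parts attained in weak-star neighbourhoods\<close>

lemma open_weak_neighbourhood:
  assumes "finite A"
  shows "open {x. \<forall>\<psi>\<in>A. cmod (cdual_apply \<psi> x - cdual_apply z \<psi>) < e}"
proof -
  have "open {x. cmod (cdual_apply \<psi> x - cdual_apply z \<psi>) < e}" for \<psi>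
    by (intro open_Collect_less continuous_intros linear_continuous_on bounded_linear_cdual_apply)
  then have "open (\<Inter>\<psi>\<in>A. {x. cmod (cdual_apply \<psi> x - cdual_apply z \<psi>) < e})"
    using assms by (intro open_INT) auto
  moreover have "(\<Inter>\<psi>\<in>A. {x. cmod (cdual_apply \<psi> x - cdual_apply z \<psi>) < e})
      = {x. \<forall>\<psi>\<in>A. cmod (cdual_apply \<psi> x - cdual_apply z \<psi>) < e}"
    by auto
  ultimately show ?thesis
    by simp
qed

text \<open>Goldstine's theorem yields a point of the ball; moving it along a vector in the common kernel of \<open>A\<close>
  leaves the functionals in \<open>A\<close> unchanged and reaches the unit sphere. This is where infinite dimension is used.\<close>

lemma weak_neighbourhood_meets_sphere:
  fixes z :: "'a::complex_normed_vector cdual cdual"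
  assumes infinite_dim: "\<nexists>S :: 'a set. finite S \<and> complex_vector.span S = UNIV"
    and z: "norm z \<le> 1" and A: "finite A" and e: "0 < e"
  obtains s where "norm s = 1" "\<And>\<psi>. \<psi> \<in> A \<Longrightarrow> cmod (cdual_apply \<psi> s - cdual_apply z \<psi>) < e"
proof -
  obtain x where x: "x \<in> ball 0 1" "\<And>\<psi>. \<psi> \<in> A \<Longrightarrow> cmod (cdual_apply \<psi> x - cdual_apply z \<psi>) < e"
    using goldstine[OF z A e] by blast
  obtain y :: 'a where y: "y \<noteq> 0" "\<And>\<psi>. \<psi> \<in> A \<Longrightarrow> cdual_apply \<psi> y = 0"
    using common_kernel_nontrivial[OF infinite_dim A] by blast
  have "\<exists>t\<ge>0. t \<le> 2 / norm y \<and> norm (x + t *\<^sub>R y) = 1"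
  proof (rule IVT')
    show "norm (x + 0 *\<^sub>R y) \<le> 1"
      using x(1) by simp
    have "norm ((2 / norm y) *\<^sub>R y) = 2"
      using y(1) by simp
    then show "1 \<le> norm (x + (2 / norm y) *\<^sub>R y)"
      using x(1) norm_diff_ineq[of "(2 / norm y) *\<^sub>R y" x] by (simp add: add.commute)
  qed (auto intro!: continuous_intros)
  then obtain t where "norm (x + t *\<^sub>R y) = 1"
    by blast
  then show thesis
    using x(2) y(2) by (intro that[of "x + t *\<^sub>R y"]) (auto simp: cdual_apply_linear_simps)
qed

text \<open>A weak-star neighbourhood of \<open>z\<close> is norm open in the space and meets the unit sphere, so it contains a unit
  vector \<open>u\<close> in the direction of some \<open>d n\<close>, and with it the end of the radius towards \<open>u\<close>. There \<open>\<phi> n\<close> tends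
  to \<open>1\<close>, the real part of the sum tends to minus infinity, and it takes all intermediate values.
  Only the real part is controlled; the position within the half-strip is not.\<close>

lemma Re_log_sum_attains:
  fixes \<phi> :: "nat \<Rightarrow> 'a::complex_normed_vector cdual"
  assumes infinite_dim: "\<nexists>S :: 'a set. finite S \<and> complex_vector.span S = UNIV"
    and norm_le: "\<And>n. norm (\<phi> n) \<le> 1"
    and peak: "\<And>n. cdual_apply (\<phi> n) (d n) = complex_of_real (norm (d n))"
    and dense: "\<And>U. open U \<Longrightarrow> U \<noteq> {} \<Longrightarrow> \<exists>n. d n \<in> U"
    and z: "norm z \<le> 1" and A: "finite A" and e: "0 < e"
  obtains T0 where "\<And>T. T0 \<le> T \<Longrightarrow> \<exists>x\<in>ball 0 1.
    (\<forall>\<psi>\<in>A. cmod (cdual_apply \<psi> x - cdual_apply z \<psi>) < e) \<and> Re (log_sum \<phi> x) = - T"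
proof -
  define U where "U = {x. \<forall>\<psi>\<in>A. cmod (cdual_apply \<psi> x - cdual_apply z \<psi>) < e}"
  have U: "open U"
    unfolding U_def by (rule open_weak_neighbourhood[OF A])
  obtain s where s: "norm s = 1" and "\<And>\<psi>. \<psi> \<in> A \<Longrightarrow> cmod (cdual_apply \<psi> s - cdual_apply z \<psi>) < e"
    using weak_neighbourhood_meets_sphere[OF infinite_dim z A e] by blast
  then have sU: "s \<in> U"
    by (simp add: U_def)
  have "open (- {0} \<inter> (\<lambda>v. v /\<^sub>R norm v) -` U)"
    by (intro continuous_open_preimage U continuous_intros) auto
  moreover have "s \<in> - {0} \<inter> (\<lambda>v. v /\<^sub>R norm v) -` U"
    using s sU by auto
  ultimately obtain n where n: "d n \<noteq> 0" "d n /\<^sub>R norm (d n) \<in> U"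
    using dense[of "- {0} \<inter> (\<lambda>v. v /\<^sub>R norm v) -` U"] by auto
  define u where "u = d n /\<^sub>R norm (d n)"
  have u: "norm u = 1" "u \<in> U" "cdual_apply (\<phi> n) u = 1"
    using n by (simp_all add: u_def cdual_apply_linear_simps peak scaleR_conv_of_real)
  have "open ((\<lambda>r. r *\<^sub>R u) -` U)"
    using U by (intro open_vimage continuous_intros)
  moreover have "1 \<in> (\<lambda>r. r *\<^sub>R u) -` U"
    using u by simp
  ultimately obtain \<delta> where \<delta>: "0 < \<delta>" "ball 1 \<delta> \<subseteq> (\<lambda>r. r *\<^sub>R u) -` U"
    using openE by blast
  define R where "R = max 0 (1 - \<delta> / 2)"
  have R: "0 \<le> R" "R < 1"
    using \<delta>(1) by (auto simp: R_def)
  have in_U: "r *\<^sub>R u \<in> U" if "R \<le> r" "r < 1" for r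
    using \<delta> that by (auto simp: R_def dist_real_def subset_iff)
  have in_ball: "r *\<^sub>R u \<in> ball 0 1" if "R \<le> r" "r < 1" for r
    using R that u by simp
  define \<gamma> where "\<gamma> r = Re (log_sum \<phi> (r *\<^sub>R u))" for r
  have cont: "continuous_on {R..r} \<gamma>" if "r < 1" for r
  proof (rule continuous_at_imp_continuous_on, rule ballI)
    fix r' assume "r' \<in> {R..r}"
    then have "isCont (log_sum \<phi>) (r' *\<^sub>R u)"
      using that by (intro isCont_log_sum norm_le in_ball) auto
    then show "isCont \<gamma> r'"
      unfolding \<gamma>_def
      by (intro isCont_Re isCont_o2[of r' "\<lambda>r. r *\<^sub>R u" "log_sum \<phi>"]) (auto intro!: continuous_intros)
  qed
  have "\<exists>x\<in>ball 0 1. (\<forall>\<psi>\<in>A. cmod (cdual_apply \<psi> x - cdual_apply z \<psi>) < e) \<and> Re (log_sum \<phi> x) = - T"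
    if T: "- \<gamma> R \<le> T" for T
  proof -
    \<comment> \<open>chosen so that the \<open>n\<close>-th term alone is at most \<open>- T\<close>\<close>
    define r where "r = max R (1 - 2 * exp (- (T * 2 ^ n)))"
    have r: "R \<le> r" "r < 1"
      using R by (auto simp: r_def)
    have "\<gamma> r \<le> (1 / 2) ^ n * Re (Ln ((1 - complex_of_real r) / 2))"
      using Re_log_sum_le[of \<phi>, OF norm_le in_ball[OF r], of n] u(3)
      by (simp add: \<gamma>_def cdual_apply_linear_simps scaleR_conv_of_real)
    also have "(1 - complex_of_real r) / 2 = complex_of_real ((1 - r) / 2)"
      by simp
    also have "Re (Ln \<dots>) = ln ((1 - r) / 2)"
      using r by (subst Ln_of_real) auto
    also have "(1 / 2) ^ n * ln ((1 - r) / 2) \<le> (1 / 2) ^ n * - (T * 2 ^ n)"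
    proof (rule mult_left_mono)
      have "(1 - r) / 2 \<le> exp (- (T * 2 ^ n))"
        by (auto simp: r_def)
      then have "ln ((1 - r) / 2) \<le> ln (exp (- (T * 2 ^ n)))"
        using r by (subst ln_le_cancel_iff) auto
      then show "ln ((1 - r) / 2) \<le> - (T * 2 ^ n)"
        by simp
    qed simp
    also have "\<dots> = - T"
      by (simp add: power_divide)
    finally have "\<gamma> r \<le> - T" .
    then obtain r' where r': "R \<le> r'" "r' \<le> r" "\<gamma> r' = - T"
      using IVT2'[of \<gamma> r "- T" R] T r cont[OF r(2)] by auto
    then have "r' *\<^sub>R u \<in> U" "r' *\<^sub>R u \<in> ball 0 1"
      using in_U[of r'] in_ball[of r'] r by linarith+
    then show ?thesis
      using r'(3) by (intro bexI[of _ "r' *\<^sub>R u"]) (auto simp: U_def \<gamma>_def)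
  qed
  then show thesis
    using that by blast
qed

section \<open>A slowly oscillating function of one variable\<close>

text \<open>On the half-strip, \<open>v = Ln (1 - u)\<close> is close to the real number \<open>ln (1 + T)\<close> when \<open>Re u = - T\<close> is large, whatever
  the bounded imaginary part of \<open>u\<close>. The first factor turns with unit speed in \<open>v\<close>, the second one
  varies on the still slower scale \<open>ln v\<close>; phase and modulus can therefore be prescribed independently of
  each other by the choice of \<open>T\<close> alone.\<close>

definition osc :: "complex \<Rightarrow> complex" where
  "osc u = exp (\<i> * Ln (1 - u)) * sin (Ln (1 + Ln (1 - u)))"

lemma Re_one_plus_Ln:
  assumes "Re u < 1 / 2"
  shows "0 < Re (1 + Ln (1 - u))"
proof -
  have "1 / 2 < cmod (1 - u)"
    using assms complex_Re_le_cmod[of "1 - u"] by simp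
  then have "ln (1 / 2) < ln (cmod (1 - u))"
    by (subst ln_less_cancel_iff) auto
  moreover have "1 - u \<noteq> 0"
    using assms by auto
  ultimately show ?thesis
    using ln_2_less_1 by (simp add: ln_div)
qed

lemma osc_holomorphic: "osc holomorphic_on {u. Re u < 1 / 2}"
proof -
  have "1 - u \<notin> \<real>\<^sub>\<le>\<^sub>0" if "Re u < 1 / 2" for u
    using that by (auto simp: complex_nonpos_Reals_iff)
  moreover have "1 + Ln (1 - u) \<notin> \<real>\<^sub>\<le>\<^sub>0" if "Re u < 1 / 2" for u
    using Re_one_plus_Ln[OF that] by (auto simp: complex_nonpos_Reals_iff)
  ultimately show ?thesis
    unfolding osc_def[abs_def] by (intro holomorphic_intros) auto
qed

lemma osc_bounded:
  assumes "Re u \<le> 0"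
  shows "cmod (osc u) \<le> exp pi"
proof -
  define v where "v = Ln (1 - u)"
  define w where "w = Ln (1 + v)"
  have v: "\<bar>Im v\<bar> \<le> pi / 2"
    using assms Re_Ln_pos_lt_imp[of "1 - u"] by (simp add: v_def)
  have w: "\<bar>Im w\<bar> \<le> pi / 2"
    using Re_one_plus_Ln[of u] assms Re_Ln_pos_lt_imp[of "1 + v"] by (simp add: w_def v_def)
  have "cmod (sin w) = cmod (exp (\<i> * w) - exp (- (\<i> * w))) / 2"
    by (simp add: sin_exp_eq norm_divide norm_mult)
  also have "\<dots> \<le> (cmod (exp (\<i> * w)) + cmod (exp (- (\<i> * w)))) / 2"
    by (intro divide_right_mono norm_triangle_ineq4) simp
  also have "\<dots> \<le> (exp (pi / 2) + exp (pi / 2)) / 2"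
    using w by (intro divide_right_mono add_mono) auto
  finally have "cmod (sin w) \<le> exp (pi / 2)"
    by simp
  moreover have "cmod (exp (\<i> * v)) \<le> exp (pi / 2)"
    using v by simp
  ultimately have "cmod (exp (\<i> * v) * sin w) \<le> exp (pi / 2) * exp (pi / 2)"
    unfolding norm_mult by (intro mult_mono) auto
  also have "\<dots> = exp pi"
    by (simp flip: exp_add)
  finally show ?thesis
    by (simp add: osc_def v_def w_def)
qed

text \<open>With \<open>Re (u k) = 1 - exp (\<tau> k)\<close> both logarithms differ from their real counterparts \<open>\<tau> k\<close> and
  \<open>ln (1 + \<tau> k)\<close> by errors \<open>\<eta> k\<close> and \<open>\<kappa> k\<close> that tend to zero.\<close>

lemma osc_tendsto:
  assumes \<tau>: "filterlim \<tau> at_top sequentially" "\<And>k. 0 \<le> \<tau> k" "\<And>k. cis (\<tau> k) = cis \<theta>"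
    and sin: "(\<lambda>k. sin (ln (1 + \<tau> k))) \<longlonglongrightarrow> \<rho>"
    and u: "\<And>k. Re (u k) = 1 - exp (\<tau> k)" "\<And>k. \<bar>Im (u k)\<bar> \<le> C"
  shows "(\<lambda>k. osc (u k)) \<longlonglongrightarrow> complex_of_real \<rho> * cis \<theta>"
proof -
  define \<eta> where "\<eta> k = Ln (1 - \<i> * of_real (Im (u k) * exp (- \<tau> k)))" for k
  define \<kappa> where "\<kappa> k = Ln (1 + \<eta> k / of_real (1 + \<tau> k))" for k
  have expm: "(\<lambda>k. exp (- \<tau> k)) \<longlonglongrightarrow> 0"
    using \<tau>(1) by (intro filterlim_compose[OF exp_at_bot]) (simp add: filterlim_uminus_at_top[symmetric])
  have "(\<lambda>k. C * exp (- \<tau> k)) \<longlonglongrightarrow> 0"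
    using tendsto_mult_left[OF expm, of C] by simp
  then have "(\<lambda>k. Im (u k) * exp (- \<tau> k)) \<longlonglongrightarrow> 0"
    by (rule Lim_null_comparison[rotated]) (auto simp: abs_mult u(2) mult_right_mono)
  then have "(\<lambda>k. 1 - \<i> * of_real (Im (u k) * exp (- \<tau> k))) \<longlonglongrightarrow> 1 - \<i> * of_real 0"
    by (intro tendsto_intros)
  then have "\<eta> \<longlonglongrightarrow> Ln (1 - \<i> * of_real 0)"
    unfolding \<eta>_def by (intro tendsto_Ln) auto
  then have \<eta>: "\<eta> \<longlonglongrightarrow> 0"
    by simp
  have "filterlim (\<lambda>k. 1 + \<tau> k) at_infinity sequentially"
    using \<tau>(1) by (intro filterlim_at_top_imp_at_infinity filterlim_tendsto_add_at_top[OF tendsto_const])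
  then have "filterlim (\<lambda>k. complex_of_real (1 + \<tau> k)) at_infinity sequentially"
    unfolding filterlim_at_infinity_conv_norm_at_top norm_of_real real_norm_def .
  from tendsto_divide_0[OF \<eta> this] have q: "(\<lambda>k. 1 + \<eta> k / of_real (1 + \<tau> k)) \<longlonglongrightarrow> 1 + 0"
    by (intro tendsto_add tendsto_const)
  then have "\<kappa> \<longlonglongrightarrow> Ln (1 + 0)"
    unfolding \<kappa>_def by (intro tendsto_Ln) auto
  then have \<kappa>: "\<kappa> \<longlonglongrightarrow> 0"
    by simp
  have v: "Ln (1 - u k) = of_real (\<tau> k) + \<eta> k" for k
  proof -
    have "1 - u k = of_real (exp (\<tau> k)) * (1 - \<i> * of_real (Im (u k) * exp (- \<tau> k)))"
      by (simp add: complex_eq_iff u(1) exp_minus power2_eq_square)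
    also have "Ln \<dots> = of_real (ln (exp (\<tau> k))) + \<eta> k"
      unfolding \<eta>_def by (subst Ln_times_of_real) (auto simp: Ln_of_real complex_eq_iff simp del: of_real_exp)
    finally show ?thesis
      by simp
  qed
  have "\<forall>\<^sub>F k in sequentially. 1 + \<eta> k / of_real (1 + \<tau> k) \<noteq> 0"
    using tendsto_imp_eventually_ne[OF q, of 0] by simp
  then have w: "\<forall>\<^sub>F k in sequentially. Ln (1 + Ln (1 - u k)) = of_real (ln (1 + \<tau> k)) + \<kappa> k"
  proof eventually_elim
    case (elim k)
    have pos: "0 < 1 + \<tau> k"
      using \<tau>(2)[of k] by simp
    have "1 + Ln (1 - u k) = of_real (1 + \<tau> k) + \<eta> k"
      by (simp add: v)
    also have "\<dots> = of_real (1 + \<tau> k) * (1 + \<eta> k / of_real (1 + \<tau> k))"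
      using pos by (simp only: distrib_left nonzero_mult_div_cancel_left of_real_eq_0_iff
          times_divide_eq_right mult_1_right less_imp_neq[THEN not_sym, of 0] simp_thms)
    also have "Ln \<dots> = of_real (ln (1 + \<tau> k)) + \<kappa> k"
      unfolding \<kappa>_def using pos elim by (subst Ln_times_of_real) (simp_all add: Ln_of_real del: of_real_add)
    finally show ?case .
  qed
  have "(\<lambda>k. sin (of_real (ln (1 + \<tau> k)) + \<kappa> k)) \<longlonglongrightarrow> of_real \<rho> * 1 + 0"
  proof -
    have "(\<lambda>k. complex_of_real (sin (ln (1 + \<tau> k))) * cos (\<kappa> k)) \<longlonglongrightarrow> of_real \<rho> * cos 0"
      by (intro tendsto_intros sin \<kappa>)
    moreover have "(\<lambda>k. complex_of_real (cos (ln (1 + \<tau> k))) * sin (\<kappa> k)) \<longlonglongrightarrow> 0"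
    proof (rule Lim_null_comparison)
      have "cmod (complex_of_real (cos (ln (1 + \<tau> k))) * sin (\<kappa> k)) \<le> cmod (sin (\<kappa> k))" for k
        by (simp add: norm_mult mult_left_le_one_le)
      then show "\<forall>\<^sub>F k in sequentially. cmod (complex_of_real (cos (ln (1 + \<tau> k))) * sin (\<kappa> k)) \<le> cmod (sin (\<kappa> k))"
        by simp
      have "(\<lambda>k. cmod (sin (\<kappa> k))) \<longlonglongrightarrow> cmod (sin 0)"
        by (intro tendsto_intros \<kappa>)
      then show "(\<lambda>k. cmod (sin (\<kappa> k))) \<longlonglongrightarrow> 0"
        by simp
    qed
    ultimately show ?thesis
      unfolding sin_add by (intro tendsto_add) (simp_all flip: sin_of_real cos_of_real)
  qed
  then have "(\<lambda>k. sin (Ln (1 + Ln (1 - u k)))) \<longlonglongrightarrow> of_real \<rho>"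
    using w by (simp add: tendsto_cong[OF eventually_mono[OF w, where Q = "\<lambda>k. sin (Ln (1 + Ln (1 - u k))) = sin (of_real (ln (1 + \<tau> k)) + \<kappa> k)"]])
  moreover have "(\<lambda>k. exp (\<i> * Ln (1 - u k))) \<longlonglongrightarrow> cis \<theta> * exp (\<i> * 0)"
  proof -
    have "exp (\<i> * Ln (1 - u k)) = cis \<theta> * exp (\<i> * \<eta> k)" for k
      using \<tau>(3)[of k] by (simp add: v distrib_left exp_add cis_conv_exp)
    then show ?thesis
      by (simp only:) (intro tendsto_intros \<eta>)
  qed
  ultimately have "(\<lambda>k. osc (u k)) \<longlonglongrightarrow> (cis \<theta> * exp (\<i> * 0)) * of_real \<rho>"
    unfolding osc_def by (intro tendsto_mult)
  then show ?thesis
    by (simp add: mult.commute)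
qed

text \<open>Start from points \<open>exp (s k)\<close> at whose logarithm the sine equals \<open>\<rho>\<close> and correct them by a bounded amount to
  reach the phase \<open>\<theta>\<close>. A bounded shift of a large number does not affect its logarithm in the limit.\<close>

lemma phases_with_prescribed_slow_sine:
  assumes \<rho>: "0 \<le> \<rho>" "\<rho> \<le> 1" and \<theta>: "0 \<le> \<theta>"
  obtains \<tau> :: "nat \<Rightarrow> real" where "filterlim \<tau> at_top sequentially" "\<And>k. 0 \<le> \<tau> k"
    "\<And>k. cis (\<tau> k) = cis \<theta>" "(\<lambda>k. sin (ln (1 + \<tau> k))) \<longlonglongrightarrow> \<rho>"
proof -
  define s where "s k = arcsin \<rho> + 2 * pi * real k" for k
  define N where "N k = nat \<lfloor>exp (s k) / (2 * pi)\<rfloor>" for k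
  define \<tau> where "\<tau> k = 2 * pi * real (N k) + \<theta>" for k
  have N: "real (N k) \<le> exp (s k) / (2 * pi)" "exp (s k) / (2 * pi) < real (N k) + 1" for k
    unfolding N_def by (simp_all add: of_nat_nat)
  have upper: "\<tau> k \<le> exp (s k) + \<theta>" and lower: "exp (s k) - 2 * pi \<le> \<tau> k" for k
    using N[of k] \<theta> by (simp_all add: \<tau>_def field_simps)
  have "filterlim s at_top sequentially"
    unfolding s_def
    by (intro filterlim_tendsto_add_at_top[OF tendsto_const]
        filterlim_tendsto_pos_mult_at_top[OF tendsto_const] filterlim_real_sequentially) simp
  then have exps: "filterlim (\<lambda>k. exp (s k)) at_top sequentially"
    by (rule filterlim_compose[OF exp_at_top])
  have \<tau>0: "0 \<le> \<tau> k" for k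
    using \<theta> by (simp add: \<tau>_def)
  have "filterlim (\<lambda>k. - (2 * pi) + exp (s k)) at_top sequentially"
    by (intro filterlim_tendsto_add_at_top[OF tendsto_const exps])
  then have "filterlim \<tau> at_top sequentially"
    by (rule filterlim_at_top_mono) (use lower in \<open>auto simp: algebra_simps\<close>)
  moreover have "cis (\<tau> k) = cis \<theta>" for k
    by (simp add: \<tau>_def cis_mult[symmetric] cis_multiple_2pi)
  moreover have "(\<lambda>k. sin (ln (1 + \<tau> k))) \<longlonglongrightarrow> \<rho>"
  proof -
    have "(\<lambda>k. (1 + \<tau> k) / exp (s k) - 1) \<longlonglongrightarrow> 0"
    proof (rule Lim_null_comparison)
      have "\<bar>1 + \<tau> k - exp (s k)\<bar> \<le> 1 + 2 * pi + \<theta>" for k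
        using upper[of k] lower[of k] \<theta> pi_gt_zero by linarith
      then have "\<bar>(1 + \<tau> k) / exp (s k) - 1\<bar> \<le> (1 + 2 * pi + \<theta>) / exp (s k)" for k
      proof -
        have "(1 + \<tau> k) / exp (s k) - 1 = (1 + \<tau> k - exp (s k)) / exp (s k)"
          by (simp add: diff_divide_distrib)
        then show ?thesis
          using \<open>\<bar>1 + \<tau> k - exp (s k)\<bar> \<le> 1 + 2 * pi + \<theta>\<close> by (simp add: divide_right_mono)
      qed
      then show "\<forall>\<^sub>F k in sequentially. norm ((1 + \<tau> k) / exp (s k) - 1) \<le> (1 + 2 * pi + \<theta>) / exp (s k)"
        by simp
      show "(\<lambda>k. (1 + 2 * pi + \<theta>) / exp (s k)) \<longlonglongrightarrow> 0"
        by (intro tendsto_divide_0[OF tendsto_const] filterlim_at_top_imp_at_infinity exps)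
    qed
    then have "(\<lambda>k. (1 + \<tau> k) / exp (s k)) \<longlonglongrightarrow> 1"
      by (simp add: LIM_zero_iff)
    then have "(\<lambda>k. sin (arcsin \<rho> + ln ((1 + \<tau> k) / exp (s k)))) \<longlonglongrightarrow> sin (arcsin \<rho> + ln 1)"
      by (intro tendsto_intros) auto
    moreover have "sin (arcsin \<rho> + ln ((1 + \<tau> k) / exp (s k))) = sin (ln (1 + \<tau> k))" for k
    proof -
      have "arcsin \<rho> + ln ((1 + \<tau> k) / exp (s k)) = ln (1 + \<tau> k) - 2 * pi * real k"
        using \<tau>0[of k] by (simp add: ln_div s_def)
      then show ?thesis
        using sin_2npi[of k] cos_2npi[of k] by (simp add: sin_diff mult.assoc mult.commute[of pi])
    qed
    ultimately show ?thesis
      using \<rho> by simp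
  qed
  ultimately show thesis
    using that \<tau>0 by blast
qed

section \<open>A function whose cluster sets all contain the unit disk\<close>

text \<open>Composing the sum of logarithms with the oscillating function gives a bounded function. Every weak-star
  neighbourhood of every \<open>z\<close> contains points at which the sum has the prescribed real parts
  \<open>1 - exp (\<tau> k)\<close>, and along them the composition tends to an arbitrary point of the unit disk.\<close>

theorem full_cluster_sets:
  assumes separable: "separable_space (euclidean :: 'a::complex_normed_vector topology)"
    and infinite_dim: "\<nexists>S :: 'a set. finite S \<and> complex_vector.span S = UNIV"
  obtains f :: "'a::complex_normed_vector \<Rightarrow> complex" where "f \<in> Hinf" "\<And>z. z \<in> cball 0 1 \<Longrightarrow> ball 0 1 \<subseteq> cluster_set f z"
proof -
  obtain D :: "'a set" where D: "countable D" "closure D = UNIV"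
    using separable by (auto simp: separable_space_def)
  define d where "d = from_nat_into D"
  have "D \<noteq> {}"
    using D(2) by auto
  then have dense: "\<exists>n. d n \<in> U" if "open U" "U \<noteq> {}" for U
    using that D open_Int_closure_eq_empty[of U D] from_nat_into_surj[OF D(1)]
    by (auto simp: d_def)
  have "\<exists>\<psi>. norm \<psi> \<le> 1 \<and> cdual_apply \<psi> (d n) = complex_of_real (norm (d n))" for n
    using norming_functional[of "d n"] by metis
  then obtain \<phi> where norm_le: "\<And>n. norm (\<phi> n) \<le> 1"
    and peak: "\<And>n. cdual_apply (\<phi> n) (d n) = complex_of_real (norm (d n))"
    by metis
  define f where "f = (\<lambda>x\<in>ball 0 1. osc (log_sum \<phi> x))"
  have "\<exists>D. (f has_derivative cdual_apply D) (at x)" if x: "x \<in> ball 0 1" for x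
  proof -
    have "log_sum \<phi> x \<in> {u. Re u < 1 / 2}"
      using Re_log_sum_nonpos[of \<phi>, OF norm_le x] by simp
    then have "(osc has_field_derivative deriv osc (log_sum \<phi> x)) (at (log_sum \<phi> x))"
      using holomorphic_derivI[OF osc_holomorphic open_halfspace_Re_lt] by blast
    then obtain D where D: "((\<lambda>x. osc (log_sum \<phi> x)) has_derivative cdual_apply D) (at x)"
      using log_sum_has_derivative[of \<phi>, OF norm_le x] cdual_derivative_chain by blast
    have "(f has_derivative cdual_apply D) (at x)"
      by (rule has_derivative_transform_within_open[OF D open_ball x]) (simp add: f_def)
    then show ?thesis
      by blast
  qed
  moreover have "bounded (f ` ball 0 1)"
    by (rule boundedI[of _ "exp pi"]) (auto simp: f_def intro!: osc_bounded Re_log_sum_nonpos norm_le)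
  ultimately have "f \<in> Hinf"
    by (simp add: Hinf_def f_def)
  moreover have "ball 0 1 \<subseteq> cluster_set f z" if z: "z \<in> cball 0 1" for z
  proof
    fix l :: complex assume l: "l \<in> ball 0 1"
    have l_eq: "l = of_real (cmod l) * cis (Arg2pi l)"
      using Arg2pi_eq[of l] by (simp add: cis_conv_exp)
    obtain \<tau> where \<tau>: "filterlim \<tau> at_top sequentially" "\<And>k. 0 \<le> \<tau> k" "\<And>k. cis (\<tau> k) = cis (Arg2pi l)"
      "(\<lambda>k. sin (ln (1 + \<tau> k))) \<longlonglongrightarrow> cmod l"
      using l Arg2pi_ge_0[of l] by (elim phases_with_prescribed_slow_sine[of "cmod l" "Arg2pi l", rotated 3]) auto
    show "l \<in> cluster_set f z"
    proof (rule cluster_setI)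
      fix A :: "'a cdual set" and e :: real assume A: "finite A" and e: "0 < e"
      obtain T0 where T0: "\<And>T. T0 \<le> T \<Longrightarrow> \<exists>x\<in>ball 0 1.
          (\<forall>\<psi>\<in>A. cmod (cdual_apply \<psi> x - cdual_apply z \<psi>) < e) \<and> Re (log_sum \<phi> x) = - T"
        using Re_log_sum_attains[OF infinite_dim norm_le peak dense _ A e, of z] z by auto
      have "\<forall>\<^sub>F k in sequentially. T0 + 1 \<le> exp (\<tau> k)"
        using filterlim_compose[OF exp_at_top \<tau>(1)] by (simp add: filterlim_at_top)
      then obtain K where K: "\<And>k. K \<le> k \<Longrightarrow> T0 + 1 \<le> exp (\<tau> k)"
        by (auto simp: eventually_sequentially)
      have "\<exists>x\<in>ball 0 1. (\<forall>\<psi>\<in>A. cmod (cdual_apply \<psi> x - cdual_apply z \<psi>) < e) \<and>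
          Re (log_sum \<phi> x) = - (exp (\<tau> (k + K)) - 1)" for k
        using K[of "k + K"] by (intro T0) simp
      then obtain x where x: "\<And>k. x k \<in> ball 0 1"
        "\<And>k \<psi>. \<psi> \<in> A \<Longrightarrow> cmod (cdual_apply \<psi> (x k) - cdual_apply z \<psi>) < e"
        "\<And>k. Re (log_sum \<phi> (x k)) = 1 - exp (\<tau> (k + K))"
        by (auto simp: Bex_def) metis
      have "(\<lambda>k. osc (log_sum \<phi> (x k))) \<longlonglongrightarrow> of_real (cmod l) * cis (Arg2pi l)"
      proof (rule osc_tendsto)
        show "filterlim (\<lambda>k. \<tau> (k + K)) at_top sequentially"
          using \<tau>(1) by (rule filterlim_compose) (rule filterlim_add_const_nat_at_top)
        show "(\<lambda>k. sin (ln (1 + \<tau> (k + K)))) \<longlonglongrightarrow> cmod l"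
          using \<tau>(4) by (rule LIMSEQ_ignore_initial_segment)
        show "\<bar>Im (log_sum \<phi> (x k))\<bar> \<le> pi" for k
          by (rule abs_Im_log_sum_le[of \<phi>, OF norm_le x(1)])
      qed (use \<tau> x in auto)
      then have "(\<lambda>k. f (x k)) \<longlonglongrightarrow> l"
        using l_eq x(1) by (simp add: f_def)
      then have "\<forall>\<^sub>F k in sequentially. dist (f (x k)) l < e"
        using e by (rule tendstoD)
      then obtain k where "dist (f (x k)) l < e"
        by (auto simp: eventually_sequentially)
      then show "\<exists>x\<in>ball 0 1. (\<forall>\<psi>\<in>A. cmod (cdual_apply \<psi> x - cdual_apply z \<psi>) < e) \<and> cmod (f x - l) < e"
        using x(1,2) by (intro bexI[of _ "x k"]) (auto simp: dist_norm)
    qed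
  qed
  ultimately show thesis
    using that by blast
qed

section \<open>Rationally independent reals\<close>

text \<open>\<open>S n\<close> collects the rational combinations of at most \<open>n\<close> elements of \<open>B\<close>.\<close>

lemma card_rational_span_le:
  fixes S :: "nat \<Rightarrow> real set"
  assumes B: "infinite B" and S0: "S 0 = {0}"
    and S_Suc: "\<And>n. S (Suc n) = (\<lambda>(q, b, x). of_rat q * b + x) ` (UNIV \<times> B \<times> S n)"
  shows "|\<Union>n. S n| \<le>o |B|"
proof -
  have nat: "|UNIV :: nat set| \<le>o |B|"
    using B by (simp add: infinite_iff_card_of_nat)
  have "|UNIV :: rat set| \<le>o |UNIV :: nat set|"
    by (rule card_of_ordLeqI[of to_nat]) auto
  then have rat: "|UNIV :: rat set| \<le>o |B|"
    using nat by (rule ordLeq_transitive)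
  have times: "|C \<times> D| \<le>o |B|" if "|C| \<le>o |B|" "|D| \<le>o |B|" for C :: "'c set" and D :: "'d set"
    using card_of_Sigma_ordLeq_infinite[OF B that(1), of "\<lambda>_. D"] that(2) by simp
  have "|S n| \<le>o |B|" for n
  proof (induction n)
    case 0
    have "B \<noteq> {}"
      using B by auto
    then show ?case
      unfolding S0 by (rule card_of_singl_ordLeq)
  next
    case (Suc n)
    have "|(UNIV :: rat set) \<times> B \<times> S n| \<le>o |B|"
      by (intro times rat Suc card_of_refl[THEN ordIso_imp_ordLeq])
    then show ?case
      unfolding S_Suc by (rule ordLeq_transitive[OF card_of_image])
  qed
  then show ?thesis
    using nat B by (intro card_of_UNION_ordLeq_infinite) auto
qed

text \<open>A Hamel basis of the reals over the rationals works: its span has the cardinality of the basis, so the basis has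
  the cardinality of the continuum. Rational independence is applied to the coefficients \<open>m i - m' i\<close>.\<close>

lemma continuum_many_rationally_independent_reals:
  "\<exists>H :: real set. |H| =o |UNIV :: real set| \<and>
    (\<forall>(n::nat) a m m'. inj_on a {..<n} \<longrightarrow> a ` {..<n} \<subseteq> H \<longrightarrow>
      (\<Sum>i<n. real (m i) * a i) = (\<Sum>i<n. real (m' i) * a i) \<longrightarrow> (\<forall>i<n. m i = m' i))"
proof -
  interpret Q: vector_space "\<lambda>(q::rat) (x::real). of_rat q * x"
    by unfold_locales (auto simp: algebra_simps of_rat_add of_rat_mult)
  obtain H :: "real set" where H: "Q.independent H" "UNIV \<subseteq> Q.span H"
    using Q.maximal_independent_subset[of UNIV] by metis
  define S where "S = rec_nat {0} (\<lambda>_ X. (\<lambda>(q, b, x). of_rat q * b + x) ` (UNIV \<times> H \<times> X))"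
  have S0: "S 0 = {0}" and S_Suc: "S (Suc n) = (\<lambda>(q, b, x). of_rat q * b + x) ` (UNIV \<times> H \<times> S n)" for n
    by (simp_all add: S_def)
  have "x \<in> (\<Union>n. S n)" if "x \<in> Q.span H" for x
    using that
  proof (induction rule: Q.span_induct_alt)
    case base
    show ?case
      using S0 by blast
  next
    case (step q b y)
    then obtain n where "y \<in> S n"
      by blast
    then have "of_rat q * b + y \<in> S (Suc n)"
      unfolding S_Suc using step(1) by force
    then show ?case
      by blast
  qed
  then have cover: "(\<Union>n. S n) = UNIV"
    using H(2) by auto
  have "infinite H"
  proof
    assume "finite H"
    have "countable (S n)" for n
      by (induction n) (auto simp: S0 S_Suc countable_finite[OF \<open>finite H\<close>])
    then have "countable (\<Union>n. S n)"
      by simp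
    then show False
      using cover uncountable_UNIV_real by simp
  qed
  then have "|UNIV :: real set| \<le>o |H|"
    using card_rational_span_le[of H S, OF _ S0 S_Suc] cover by simp
  then have card: "|H| =o |UNIV :: real set|"
    by (simp add: ordIso_iff_ordLeq card_of_mono1)
  have indep: "m i = m' i"
    if a: "inj_on a {..<n}" "a ` {..<n} \<subseteq> H" and i: "i < n"
      and eq: "(\<Sum>i<n. real (m i) * a i) = (\<Sum>i<n. real (m' i) * a i)"
    for n :: nat and a i and m m' :: "nat \<Rightarrow> nat"
  proof -
    define u :: "real \<Rightarrow> rat" where
      "u x = of_nat (m (the_inv_into {..<n} a x)) - of_nat (m' (the_inv_into {..<n} a x))" for x
    have u: "u (a j) = of_nat (m j) - of_nat (m' j)" if "j < n" for j
      using a(1) that by (simp add: u_def the_inv_into_f_f)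
    have "(\<Sum>x\<in>a ` {..<n}. of_rat (u x) * x) = (\<Sum>j<n. of_rat (u (a j)) * a j)"
      by (simp add: sum.reindex[OF a(1)])
    also have "\<dots> = (\<Sum>j<n. real (m j) * a j - real (m' j) * a j)"
      by (intro sum.cong) (auto simp: u of_rat_diff left_diff_distrib)
    also have "\<dots> = 0"
      using eq by (simp add: sum_subtractf)
    finally have "u (a i) = 0"
      using H(1) a(2) i unfolding Q.independent_explicit_finite_subsets by blast
    then show ?thesis
      using u[OF i] by simp
  qed
  show ?thesis
    using card indep by (intro exI[of _ H]) simp
qed

section \<open>Polynomials evaluated at exponential monomials\<close>

lemma power_times_exp_decay:
  fixes d :: real
  assumes "0 < d"
  shows "((\<lambda>x. x ^ k * exp (- (d * x))) \<longlongrightarrow> 0) at_top"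
proof -
  have "filterlim (\<lambda>x. d * x) at_top at_top"
    using assms by (intro filterlim_tendsto_pos_mult_at_top[OF tendsto_const] filterlim_ident)
  then have "((\<lambda>x. (d * x) ^ k / exp (d * x)) \<longlongrightarrow> 0) at_top"
    by (rule filterlim_compose[OF tendsto_power_div_exp_0])
  from tendsto_mult_left[OF this, of "1 / d ^ k"] show ?thesis
    using assms by (simp add: power_mult_distrib exp_minus field_simps)
qed

text \<open>Among the terms with nonzero coefficient the one with the largest exponential rate dominates as \<open>x\<close> tends to
  infinity, since the rates are distinct. Powers of \<open>x\<close> cannot make up for a difference in rate.\<close>

lemma exponential_polynomial_eq_0:
  fixes c :: "'m \<Rightarrow> complex" and b :: "'m \<Rightarrow> real" and k :: "'m \<Rightarrow> nat"
  assumes M: "finite M" and b: "inj_on b M"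
    and zero: "\<And>x. (\<Sum>m\<in>M. c m * of_real (x ^ k m * exp (b m * x))) = 0"
    and m: "m \<in> M"
  shows "c m = 0"
proof (rule ccontr)
  assume "c m \<noteq> 0"
  define M' where "M' = {m\<in>M. c m \<noteq> 0}"
  have M': "finite M'" "M' \<noteq> {}"
    using M m \<open>c m \<noteq> 0\<close> by (auto simp: M'_def)
  have "Max (b ` M') \<in> b ` M'"
    using M' by simp
  then obtain m0 where m0: "m0 \<in> M'" "Max (b ` M') = b m0"
    by blast
  have less: "b m < b m0" if "m \<in> M' - {m0}" for m
  proof -
    have "b m \<le> b m0"
      unfolding m0(2)[symmetric] using M'(1) that by (intro Max_ge) auto
    moreover have "b m \<noteq> b m0"
      using b that m0(1) by (auto simp: M'_def inj_on_def)
    ultimately show ?thesis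
      by simp
  qed
  have eq: "(\<Sum>m\<in>M' - {m0}. c m * of_real (x ^ k m * exp (- ((b m0 - b m) * x)))) = - c m0 * of_real (x ^ k m0)" for x
  proof -
    have "0 = of_real (exp (- (b m0 * x))) * (\<Sum>m\<in>M. c m * of_real (x ^ k m * exp (b m * x)))"
      by (simp only: zero mult_zero_right)
    also have "\<dots> = (\<Sum>m\<in>M. c m * of_real (x ^ k m * exp (- ((b m0 - b m) * x))))"
      unfolding sum_distrib_left
    proof (rule sum.cong[OF refl])
      fix m
      have "exp (- ((b m0 - b m) * x)) = exp (- (b m0 * x)) * exp (b m * x)"
        by (simp add: exp_add[symmetric] algebra_simps)
      then show "of_real (exp (- (b m0 * x))) * (c m * of_real (x ^ k m * exp (b m * x)))
          = c m * of_real (x ^ k m * exp (- ((b m0 - b m) * x)))"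
        by (simp only: of_real_mult mult_ac)
    qed
    also have "\<dots> = (\<Sum>m\<in>M'. c m * of_real (x ^ k m * exp (- ((b m0 - b m) * x))))"
      using M by (intro sum.mono_neutral_right) (auto simp: M'_def)
    also have "\<dots> = c m0 * of_real (x ^ k m0)
        + (\<Sum>m\<in>M' - {m0}. c m * of_real (x ^ k m * exp (- ((b m0 - b m) * x))))"
      using M'(1) m0(1) by (subst sum.remove[of _ m0]) auto
    finally show ?thesis
      by (simp add: eq_neg_iff_add_eq_0 add.commute)
  qed
  have "((\<lambda>x. \<Sum>m\<in>M' - {m0}. c m * of_real (x ^ k m * exp (- ((b m0 - b m) * x)))) \<longlongrightarrow>
      (\<Sum>m\<in>M' - {m0}. c m * of_real 0)) at_top"
    using less by (intro tendsto_sum tendsto_mult tendsto_const tendsto_of_real power_times_exp_decay) auto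
  then have "((\<lambda>x. - c m0 * of_real (x ^ k m0)) \<longlongrightarrow> 0) at_top"
    by (simp only: eq) simp
  then have "((\<lambda>x. cmod (- c m0 * of_real (x ^ k m0))) \<longlongrightarrow> 0) at_top"
    by (rule tendsto_norm_zero)
  moreover have "\<forall>\<^sub>F x in at_top. cmod (c m0) \<le> cmod (- c m0 * of_real (x ^ k m0))"
    using eventually_ge_at_top[of 1]
  proof eventually_elim
    case (elim x)
    then have "1 \<le> x ^ k m0"
      by simp
    then have "cmod (c m0) * 1 \<le> cmod (c m0) * \<bar>x ^ k m0\<bar>"
      by (intro mult_left_mono) auto
    then show ?case
      by (simp only: norm_mult norm_minus_cancel norm_of_real mult_1_right)
  qed
  ultimately have "cmod (c m0) \<le> 0"
    by (rule tendsto_lowerbound) simp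
  then show False
    using m0(1) by (simp add: M'_def)
qed

lemma eval_poly_cong:
  assumes "Q \<in> polys n" "\<And>i. i < n \<Longrightarrow> v i = w i"
  shows "eval_poly Q v = eval_poly Q w"
  unfolding eval_poly_def
  using assms by (intro sum.cong prod.cong refl arg_cong2[where f = "(*)"]) (auto simp: polys_def subset_iff)

lemma eval_poly_zero: "eval_poly Q (\<lambda>_. 0) = Poly_Mapping.lookup Q 0"
proof -
  have zero: "(\<Prod>i\<in>Poly_Mapping.keys m. (0::complex) ^ Poly_Mapping.lookup m i) = (if m = 0 then 1 else 0)" for m
  proof (cases "m = 0")
    case False
    then obtain i where "i \<in> Poly_Mapping.keys m"
      by fastforce
    then show ?thesis
      using False by (auto simp: in_keys_iff intro!: prod_zero bexI[of _ i])
  qed simp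
  have "eval_poly Q (\<lambda>_. 0) = (\<Sum>m\<in>Poly_Mapping.keys Q. if m = 0 then Poly_Mapping.lookup Q m else 0)"
    unfolding eval_poly_def zero by (intro sum.cong) auto
  also have "\<dots> = Poly_Mapping.lookup Q 0"
    by (simp add: in_keys_iff)
  finally show ?thesis .
qed

lemma eval_poly_exponentials:
  assumes "Q \<in> polys n"
  shows "eval_poly Q (\<lambda>i. of_real x * exp (of_real (a i) * of_real x)) =
    (\<Sum>m\<in>Poly_Mapping.keys Q. Poly_Mapping.lookup Q m *
      of_real (x ^ (\<Sum>i<n. Poly_Mapping.lookup m i) * exp ((\<Sum>i<n. real (Poly_Mapping.lookup m i) * a i) * x)))"
  unfolding eval_poly_def
proof (intro sum.cong refl arg_cong2[where f = "(*)"])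
  fix m assume m: "m \<in> Poly_Mapping.keys Q"
  have "(\<Prod>i\<in>Poly_Mapping.keys m. (of_real x * exp (of_real (a i) * of_real x)) ^ Poly_Mapping.lookup m i)
      = (\<Prod>i<n. (of_real x * exp (of_real (a i) * of_real x)) ^ Poly_Mapping.lookup m i)"
    using assms m by (intro prod.mono_neutral_left) (auto simp: polys_def in_keys_iff)
  also have "\<dots> = complex_of_real (\<Prod>i<n. x ^ Poly_Mapping.lookup m i * exp (real (Poly_Mapping.lookup m i) * a i * x))"
    unfolding of_real_prod
    by (intro prod.cong refl) (simp add: power_mult_distrib exp_of_nat_mult[symmetric] mult.assoc flip: exp_of_real)
  also have "(\<Prod>i<n. x ^ Poly_Mapping.lookup m i * exp (real (Poly_Mapping.lookup m i) * a i * x))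
      = x ^ (\<Sum>i<n. Poly_Mapping.lookup m i) * exp ((\<Sum>i<n. real (Poly_Mapping.lookup m i) * a i) * x)"
    by (simp add: prod.distrib power_sum exp_sum sum_distrib_right)
  finally show "(\<Prod>i\<in>Poly_Mapping.keys m. (of_real x * exp (of_real (a i) * of_real x)) ^ Poly_Mapping.lookup m i)
      = complex_of_real (x ^ (\<Sum>i<n. Poly_Mapping.lookup m i) * exp ((\<Sum>i<n. real (Poly_Mapping.lookup m i) * a i) * x))" .
qed

text \<open>A monomial with exponent vector \<open>m\<close>, evaluated at the functions \<open>w * exp (a i * w)\<close>, is a power of \<open>w\<close> times an
  exponential with rate \<open>\<Sum>i<n. m i * a i\<close>; distinct monomials have distinct rates.\<close>

lemma poly_eq_0_of_exponentials:
  assumes Q: "Q \<in> polys n"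
    and indep: "\<And>m m' :: nat \<Rightarrow> nat. (\<Sum>i<n. real (m i) * a i) = (\<Sum>i<n. real (m' i) * a i) \<Longrightarrow> \<forall>i<n. m i = m' i"
    and zero: "\<And>w. eval_poly Q (\<lambda>i. w * exp (of_real (a i) * w)) = 0"
  shows "Q = 0"
proof -
  define b where "b m = (\<Sum>i<n. real (Poly_Mapping.lookup m i) * a i)" for m :: "nat \<Rightarrow>\<^sub>0 nat"
  have "inj_on b (Poly_Mapping.keys Q)"
  proof (rule inj_onI)
    fix m m' assume m: "m \<in> Poly_Mapping.keys Q" "m' \<in> Poly_Mapping.keys Q" and "b m = b m'"
    then have "\<forall>i<n. Poly_Mapping.lookup m i = Poly_Mapping.lookup m' i"
      by (intro indep) (simp add: b_def)
    moreover have "Poly_Mapping.lookup m i = 0" if "m \<in> Poly_Mapping.keys Q" "\<not> i < n" for m i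
    proof -
      have "i \<notin> Poly_Mapping.keys m"
        using Q that by (auto simp: polys_def)
      then show ?thesis
        by (simp add: in_keys_iff)
    qed
    ultimately show "m = m'"
      using m by (intro poly_mapping_eqI) metis
  qed
  moreover have "(\<Sum>m\<in>Poly_Mapping.keys Q. Poly_Mapping.lookup Q m *
      of_real (x ^ (\<Sum>i<n. Poly_Mapping.lookup m i) * exp (b m * x))) = 0" for x
    using zero[of "of_real x"] unfolding eval_poly_exponentials[OF Q] b_def .
  ultimately have "Poly_Mapping.lookup Q m = 0" if "m \<in> Poly_Mapping.keys Q" for m
    using that
    by (intro exponential_polynomial_eq_0[where M = "Poly_Mapping.keys Q" and b = b
          and k = "\<lambda>m. \<Sum>i<n. Poly_Mapping.lookup m i" and c = "Poly_Mapping.lookup Q"]) simp_all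
  then show ?thesis
    by (intro poly_mapping_eqI) (metis in_keys_iff lookup_zero)
qed

lemma eval_poly_holomorphic:
  assumes "\<And>i. g i holomorphic_on S"
  shows "(\<lambda>w. eval_poly Q (\<lambda>i. g i w)) holomorphic_on S"
  unfolding eval_poly_def by (intro holomorphic_intros assms)

section \<open>Composition with entire functions\<close>

lemma Hinf_compose_entire:
  assumes f: "f \<in> Hinf" and h: "h holomorphic_on UNIV"
  shows "(\<lambda>x\<in>ball 0 1. h (f x)) \<in> Hinf"
proof -
  have "\<exists>D. ((\<lambda>x\<in>ball 0 1. h (f x)) has_derivative cdual_apply D) (at x)" if x: "x \<in> ball 0 1" for x
  proof -
    obtain D where "(f has_derivative cdual_apply D) (at x)"
      using f x unfolding Hinf_def by blast
    then have D: "((\<lambda>x. h (f x)) has_derivative cdual_apply (deriv h (f x) *\<^sub>C D)) (at x)"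
      by (rule cdual_derivative_chain) (rule holomorphic_derivI[OF h], auto)
    show ?thesis
      by (rule exI, rule has_derivative_transform_within_open[OF D open_ball x]) simp
  qed
  moreover have "bounded ((\<lambda>x\<in>ball 0 1. h (f x)) ` ball 0 1)"
  proof -
    have "bounded (f ` ball 0 1)"
      using f by (simp add: Hinf_def)
    then have "compact (h ` closure (f ` ball 0 1))"
      using holomorphic_on_imp_continuous_on[OF h]
      by (intro compact_continuous_image) (auto simp: compact_closure intro: continuous_on_subset)
    then have "bounded (h ` closure (f ` ball 0 1))"
      by (rule compact_imp_bounded)
    then show ?thesis
      by (rule bounded_subset) (use closure_subset[of "f ` ball 0 1"] in auto)
  qed
  ultimately show ?thesis
    by (simp add: Hinf_def)
qed

lemma cluster_set_compose:
  assumes l: "l \<in> cluster_set f z" and h: "isCont h l"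
  shows "h l \<in> cluster_set (\<lambda>x\<in>ball 0 1. h (f x)) z"
proof -
  obtain F where F: "F \<noteq> bot" "\<forall>\<^sub>F x in F. x \<in> ball 0 1"
    "limitin weak_star_topology bidual_embedding z F" "(f \<longlongrightarrow> l) F"
    using l by (auto simp: cluster_set_def)
  have "((\<lambda>x. h (f x)) \<longlongrightarrow> h l) F"
    using F(4) h by (rule isCont_tendsto_compose[rotated])
  moreover have "\<forall>\<^sub>F x in F. h (f x) = (\<lambda>x\<in>ball 0 1. h (f x)) x"
    using F(2) by eventually_elim simp
  ultimately have "((\<lambda>x\<in>ball 0 1. h (f x)) \<longlongrightarrow> h l) F"
    by (rule Lim_transform_eventually)
  then show ?thesis
    using F unfolding cluster_set_def by blast
qed

lemma cluster_set_eq_0: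
  assumes l: "l \<in> cluster_set f z" and f: "\<And>x. x \<in> ball 0 1 \<Longrightarrow> f x = 0"
  shows "l = 0"
proof -
  obtain F where F: "F \<noteq> bot" "\<forall>\<^sub>F x in F. x \<in> ball 0 1" "(f \<longlongrightarrow> l) F"
    using l by (auto simp: cluster_set_def)
  have "\<forall>\<^sub>F x in F. f x = 0"
    using F(2) by eventually_elim (rule f)
  with F(3) have "((\<lambda>_. 0) \<longlongrightarrow> l) F"
    by (rule Lim_transform_eventually)
  then show ?thesis
    using F(1) by (simp add: tendsto_const_iff)
qed

lemma entire_eq_0:
  assumes h: "h holomorphic_on UNIV" and zero: "\<And>w. w \<in> ball 0 1 \<Longrightarrow> h w = 0"
  shows "h w = 0"
  by (rule analytic_continuation_open[of "ball 0 1" UNIV h "\<lambda>_. 0" w]) (use h zero in auto)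

lemma entire_disk_at_0:
  assumes h: "h holomorphic_on UNIV" "h 0 = 0" and nonzero: "h w \<noteq> 0"
  obtains r where "0 < r" "ball 0 r \<subseteq> h ` ball 0 1"
proof -
  have "\<not> h constant_on UNIV"
    using h(2) nonzero by (metis UNIV_I constant_on_def)
  then have "open (h ` ball 0 1)"
    by (intro open_mapping_thm[OF h(1)]) auto
  moreover have "0 \<in> h ` ball 0 1"
    using h(2) by force
  ultimately show thesis
    using that openE by blast
qed

section \<open>Strong algebrability\<close>

theorem theorem1p2:
  assumes separable: "separable_space (euclidean :: 'a::complex_banach topology)"
    and infinite_dim: "\<nexists>S :: 'a set. finite S \<and> complex_vector.span S = UNIV"
  shows "strongly_algebrable (ball (0::'a) 1) Hinf
    {f \<in> Hinf. \<exists>r>0. \<forall>z\<in>cball 0 1. ball 0 r \<subseteq> cluster_set f z}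
    |UNIV :: real set|"
proof -
  obtain f :: "'a \<Rightarrow> complex" where f: "f \<in> Hinf"
    and cluster: "\<And>z. z \<in> cball 0 1 \<Longrightarrow> ball 0 1 \<subseteq> cluster_set f z"
    using full_cluster_sets[OF separable infinite_dim] by blast
  obtain H :: "real set" where H: "|H| =o |UNIV :: real set|"
    and indep: "\<And>(n::nat) a m m'. inj_on a {..<n} \<Longrightarrow> a ` {..<n} \<subseteq> H \<Longrightarrow>
      (\<Sum>i<n. real (m i) * a i) = (\<Sum>i<n. real (m' i) * a i) \<Longrightarrow> \<forall>i<n. m i = m' i"
    using continuum_many_rationally_independent_reals by blast
  \<comment> \<open>\<open>f\<close> need not take every value in the unit disk, but all of them are cluster values of \<open>f\<close>.\<close>
  have vanish: "h w = 0" if h: "h holomorphic_on UNIV" and zero: "\<And>x. x \<in> ball 0 1 \<Longrightarrow> h (f x) = 0" for h w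
  proof (rule entire_eq_0[OF h])
    fix l :: complex assume "l \<in> ball 0 1"
    then have "l \<in> cluster_set f 0"
      using cluster[of 0] by auto
    moreover have "isCont h l"
      using holomorphic_on_imp_continuous_on[OF h] by (simp add: continuous_on_eq_continuous_at)
    ultimately have "h l \<in> cluster_set (\<lambda>x\<in>ball 0 1. h (f x)) 0"
      by (rule cluster_set_compose)
    then show "h l = 0"
      by (rule cluster_set_eq_0) (simp add: zero)
  qed
  define E where "E a = (\<lambda>x\<in>ball 0 1. f x * exp (of_real a * f x))" for a :: real
  have E_Hinf: "E a \<in> Hinf" for a
    unfolding E_def by (rule Hinf_compose_entire[OF f, of "\<lambda>w. w * exp (of_real a * w)"]) (intro holomorphic_intros)
  have "inj E"
  proof (rule injI)
    fix a b assume eq: "E a = E b"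
    have "f x * exp (of_real a * f x) - f x * exp (of_real b * f x) = 0" if "x \<in> ball 0 1" for x
      using that fun_cong[OF eq, of x] by (simp add: E_def)
    then have "1 * exp (of_real a * 1) - 1 * exp (of_real b * 1) = (0::complex)"
      by (intro vanish[of "\<lambda>w. w * exp (of_real a * w) - w * exp (of_real b * w)" 1] holomorphic_intros)
    then have "exp (of_real a) = (exp (of_real b) :: complex)"
      by simp
    then show "a = b"
      unfolding exp_of_real of_real_eq_iff by simp
  qed
  define G where "G = E ` H"
  have "|G| =o |H|"
    unfolding G_def using inj_on_subset[OF \<open>inj E\<close> subset_UNIV, of H]
    by (intro ordIso_symmetric[OF card_of_ordIsoI[of E]]) (simp add: inj_on_imp_bij_betw)
  then have card: "|G| =o |UNIV :: real set|"
    using H by (rule ordIso_transitive)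
  have "infinite G"
    using card_of_ordIso_finite[OF card] infinite_UNIV_char_0 by blast
  \<comment> \<open>polynomials in the generators are entire functions of \<open>f\<close>\<close>
  have pullback: "\<exists>a. (\<forall>i<n. a i \<in> H \<and> g i = E (a i)) \<and>
      poly_at_funs (ball 0 1) Q g = (\<lambda>x\<in>ball 0 1. eval_poly Q (\<lambda>i. f x * exp (of_real (a i) * f x)))"
    if Q: "Q \<in> polys n" and g: "g ` {..<n} \<subseteq> G" for Q n g
  proof -
    have "\<forall>i. \<exists>a. i < n \<longrightarrow> a \<in> H \<and> g i = E a"
      using g by (auto simp: G_def)
    then obtain a where a: "\<And>i. i < n \<Longrightarrow> a i \<in> H \<and> g i = E (a i)"
      by metis
    have "poly_at_funs (ball 0 1) Q g = (\<lambda>x\<in>ball 0 1. eval_poly Q (\<lambda>i. f x * exp (of_real (a i) * f x)))"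
      unfolding poly_at_funs_def by (rule restrict_ext, rule eval_poly_cong[OF Q]) (simp add: a E_def)
    with a show ?thesis
      by blast
  qed
  have hol: "(\<lambda>w. eval_poly Q (\<lambda>i. w * exp (of_real (a i) * w))) holomorphic_on UNIV" for Q and a :: "nat \<Rightarrow> real"
    by (intro eval_poly_holomorphic holomorphic_intros)
  have "algebraically_independent (ball 0 1) G"
    unfolding algebraically_independent_def
  proof (intro allI ballI impI, elim conjE)
    fix n Q g assume Q: "Q \<in> polys n" and inj: "inj_on g {..<n}" and g: "g ` {..<n} \<subseteq> G"
      and zero: "poly_at_funs (ball 0 1) Q g = (\<lambda>x\<in>ball 0 1. 0)"
    obtain a where a: "\<And>i. i < n \<Longrightarrow> a i \<in> H \<and> g i = E (a i)"
      and eq: "poly_at_funs (ball 0 1) Q g = (\<lambda>x\<in>ball 0 1. eval_poly Q (\<lambda>i. f x * exp (of_real (a i) * f x)))"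
      using pullback[OF Q g] by blast
    have "eval_poly Q (\<lambda>i. f x * exp (of_real (a i) * f x)) = 0" if "x \<in> ball 0 1" for x
      using fun_cong[OF trans[OF eq[symmetric] zero], of x] that by simp
    then have "eval_poly Q (\<lambda>i. w * exp (of_real (a i) * w)) = 0" for w
      by (rule vanish[OF hol[of Q a]])
    moreover have "inj_on a {..<n}"
      using inj a by (auto simp: inj_on_def)
    ultimately show "Q = 0"
      using a by (intro poly_eq_0_of_exponentials[OF Q] indep) auto
  qed
  moreover have "generated_subalgebra (ball 0 1) G \<subseteq>
      {f \<in> Hinf. \<exists>r>0. \<forall>z\<in>cball 0 1. ball 0 r \<subseteq> cluster_set f z} \<union> {\<lambda>x\<in>ball 0 1. 0}"
  proof
    fix k assume "k \<in> generated_subalgebra (ball 0 1) G"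
    then obtain n Q g where Q: "Q \<in> polys n" "Poly_Mapping.lookup Q 0 = 0" and g: "g ` {..<n} \<subseteq> G"
      and k: "k = poly_at_funs (ball 0 1) Q g"
      by (auto simp: generated_subalgebra_def)
    obtain a where eq: "k = (\<lambda>x\<in>ball 0 1. eval_poly Q (\<lambda>i. f x * exp (of_real (a i) * f x)))"
      using pullback[OF Q(1) g] k by blast
    define h where "h w = eval_poly Q (\<lambda>i. w * exp (of_real (a i) * w))" for w
    have h: "h holomorphic_on UNIV"
      unfolding h_def[abs_def] by (rule hol)
    have h0: "h 0 = 0"
      using eval_poly_zero[of Q] Q(2) by (simp add: h_def)
    have k_h: "k = (\<lambda>x\<in>ball 0 1. h (f x))"
      by (simp add: eq h_def)
    show "k \<in> {f \<in> Hinf. \<exists>r>0. \<forall>z\<in>cball 0 1. ball 0 r \<subseteq> cluster_set f z} \<union> {\<lambda>x\<in>ball 0 1. 0}"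
    proof (cases "\<exists>w. h w \<noteq> 0")
      case False
      then show ?thesis
        by (simp add: k_h)
    next
      case True
      then obtain r where r: "0 < r" "ball 0 r \<subseteq> h ` ball 0 1"
        using entire_disk_at_0[OF h h0] by blast
      have "ball 0 r \<subseteq> cluster_set k z" if z: "z \<in> cball 0 1" for z
      proof
        fix l :: complex assume "l \<in> ball 0 r"
        then obtain l' where l': "l' \<in> ball 0 1" "l = h l'"
          using r(2) by blast
        have "isCont h l'"
          using holomorphic_on_imp_continuous_on[OF h] by (simp add: continuous_on_eq_continuous_at)
        with subsetD[OF cluster[OF z] l'(1)] show "l \<in> cluster_set k z"
          unfolding k_h l'(2) by (rule cluster_set_compose)
      qed
      moreover have "k \<in> Hinf"
        unfolding k_h by (rule Hinf_compose_entire[OF f h])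
      ultimately show ?thesis
        using r(1) by blast
    qed
  qed
  moreover have "G \<subseteq> Hinf"
    using E_Hinf by (auto simp: G_def)
  ultimately show ?thesis
    unfolding strongly_algebrable_def using card \<open>infinite G\<close> by blast
qed

end
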